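(* Let $(B_0,B_1)$ be an interpolation couple of complex Banach spaces, let $\theta\in(0,1)$ and let $p\in(1,+\infty)$. Assume that the dual norm on $B_0^*$ is locally uniformly rotund. Then the dual $B_{\theta,p}^*$ of the real interpolation space $B_{\theta,p}=(B_0,B_1)_{\theta,p}$ admits an equivalent locally uniformly rotund dual norm.
   Context: An interpolation couple $(B_0,B_1)$ is a pair of complex Banach spaces continuously embedded in a common Hausdorff topological vector space. Real interpolation space: for $a\in B_0+B_1$ and $t>0$ let $K(t,a)=\inf\{\|a_0\|_{B_0}+t\|a_1\|_{B_1}: a=a_0+a_1,\ a_j\in B_j\}$. Then $B_{\theta,p}=\{a\in B_0+B_1: \|a\|_{B_{\theta,p}}=\left[\int_0^\infty (t^{-\theta}K(t,a))^p\frac{dt}{t}\right]^{1/p}<+\infty\}$, a Banach space with this norm. A norm $\|\cdot\|$ on a Banach space $X$ is locally uniformly rotund (LUR) if $\|x_n-x\|\to 0$ whenever $x\in X$ and $(x_n)$ is a sequence in $X$ with $\lim_n\|x_n\|=\|x\|$ and $\lim_n\|x_n+x\|=2\|x\|$; equivalently, whenever $2\|x_n\|^2+2\|x\|^2-\|x_n+x\|^2\to 0$. An equivalent dual norm on $X^*$ is a norm on $X^*$ that is the dual norm of some equivalent norm on $X$. *)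

theory Defs
  imports "HOL-Analysis.Analysis" "HOL-Library.Function_Algebras"
begin

text \<open>
  The distribution has no type class of complex normed spaces, and the interpolation space below
  is a subset of an ambient space with a norm of its own. A complex normed space is therefore
  a linear subspace \<open>X\<close> of a complex vector space (given by its scalar multiplication \<open>sc\<close>)
  together with a function \<open>N\<close> that is a norm on \<open>X\<close>; the values of \<open>N\<close> off \<open>X\<close> are irrelevant.
\<close>

locale complex_normed_space = vector_space sc
  for sc :: "complex \<Rightarrow> 'v::ab_group_add \<Rightarrow> 'v" +
  fixes X :: "'v set" and N :: "'v \<Rightarrow> real"
  assumes subspace_carrier: "subspace X"
    and norm_nonneg: "x \<in> X \<Longrightarrow> 0 \<le> N x"
    and norm_eq_0: "x \<in> X \<Longrightarrow> N x = 0 \<longleftrightarrow> x = 0"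
    and norm_triangle: "x \<in> X \<Longrightarrow> y \<in> X \<Longrightarrow> N (x + y) \<le> N x + N y"
    and norm_scale: "x \<in> X \<Longrightarrow> N (sc c x) = cmod c * N x"

locale complex_banach_space = complex_normed_space sc X N
  for sc :: "complex \<Rightarrow> 'v::ab_group_add \<Rightarrow> 'v" and X N +
  assumes complete: "range x \<subseteq> X \<Longrightarrow>
      (\<forall>e>0. \<exists>n0::nat. \<forall>m\<ge>n0. \<forall>n\<ge>n0. N (x m - x n) < e) \<Longrightarrow>
      \<exists>l\<in>X. (\<lambda>n. N (x n - l)) \<longlonglongrightarrow> 0"

locale complex_tvs = vector_space sc
  for sc :: "complex \<Rightarrow> 'e::{topological_ab_group_add, t2_space} \<Rightarrow> 'e" +
  assumes continuous_scale: "continuous_on UNIV (\<lambda>(c, x). sc c x)"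

text \<open>Continuity of the inclusion map from \<open>(X, N)\<close> into the ambient topological space.\<close>

definition continuously_included ::
    "'e::{topological_space, minus} set \<Rightarrow> ('e \<Rightarrow> real) \<Rightarrow> bool" where
  "continuously_included X N \<longleftrightarrow>
     (\<forall>x\<in>X. \<forall>U. open U \<and> x \<in> U \<longrightarrow> (\<exists>d>0. \<forall>y\<in>X. N (y - x) < d \<longrightarrow> y \<in> U))"

text \<open>
  The two Banach spaces are identified with their images in the ambient Hausdorff topological
  vector space, whose topology is that of the type \<open>'e\<close>.
\<close>

locale interpolation_couple =
  complex_tvs sc +
  B0: complex_banach_space sc B0 N0 +
  B1: complex_banach_space sc B1 N1
  for sc :: "complex \<Rightarrow> 'e::{topological_ab_group_add, t2_space} \<Rightarrow> 'e"
    and B0 N0 B1 N1 +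
  assumes included_B0: "continuously_included B0 N0"
    and included_B1: "continuously_included B1 N1"

definition K_functional ::
    "'e::ab_group_add set \<Rightarrow> ('e \<Rightarrow> real) \<Rightarrow> 'e set \<Rightarrow> ('e \<Rightarrow> real) \<Rightarrow> real \<Rightarrow> 'e \<Rightarrow> real" where
  "K_functional B0 N0 B1 N1 t a =
     Inf {N0 a0 + t * N1 a1 | a0 a1. a0 \<in> B0 \<and> a1 \<in> B1 \<and> a = a0 + a1}"

definition real_interp_integral ::
    "'e::ab_group_add set \<Rightarrow> ('e \<Rightarrow> real) \<Rightarrow> 'e set \<Rightarrow> ('e \<Rightarrow> real) \<Rightarrow> real \<Rightarrow> real \<Rightarrow> 'e \<Rightarrow> ennreal"
  where
  "real_interp_integral B0 N0 B1 N1 \<theta> p a =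
     (\<integral>\<^sup>+ t\<in>{0<..}. ennreal ((t powr (-\<theta>) * K_functional B0 N0 B1 N1 t a) powr p / t) \<partial>lborel)"

definition real_interp_space ::
    "'e::ab_group_add set \<Rightarrow> ('e \<Rightarrow> real) \<Rightarrow> 'e set \<Rightarrow> ('e \<Rightarrow> real) \<Rightarrow> real \<Rightarrow> real \<Rightarrow> 'e set" where
  "real_interp_space B0 N0 B1 N1 \<theta> p =
     {a. (\<exists>a0\<in>B0. \<exists>a1\<in>B1. a = a0 + a1) \<and> real_interp_integral B0 N0 B1 N1 \<theta> p a < \<infinity>}"

definition real_interp_norm ::
    "'e::ab_group_add set \<Rightarrow> ('e \<Rightarrow> real) \<Rightarrow> 'e set \<Rightarrow> ('e \<Rightarrow> real) \<Rightarrow> real \<Rightarrow> real \<Rightarrow> 'e \<Rightarrow> real" where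
  "real_interp_norm B0 N0 B1 N1 \<theta> p a =
     enn2real (real_interp_integral B0 N0 B1 N1 \<theta> p a) powr (1 / p)"

text \<open>
  Bounded complex-linear functionals on \<open>(X, N)\<close>, extended by \<open>0\<close> off \<open>X\<close>, so that distinct
  elements are distinct functionals on \<open>X\<close> and the vector operations are the pointwise ones.
\<close>

definition dual_space ::
    "(complex \<Rightarrow> 'v::ab_group_add \<Rightarrow> 'v) \<Rightarrow> 'v set \<Rightarrow> ('v \<Rightarrow> real) \<Rightarrow> ('v \<Rightarrow> complex) set" where
  "dual_space sc X N =
     {f. (\<forall>x\<in>X. \<forall>y\<in>X. f (x + y) = f x + f y) \<and>
         (\<forall>c. \<forall>x\<in>X. f (sc c x) = c * f x) \<and>
         (\<exists>C. \<forall>x\<in>X. cmod (f x) \<le> C * N x) \<and>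
         (\<forall>x. x \<notin> X \<longrightarrow> f x = 0)}"

definition dual_norm :: "'v set \<Rightarrow> ('v \<Rightarrow> real) \<Rightarrow> ('v \<Rightarrow> complex) \<Rightarrow> real" where
  "dual_norm X N f = (SUP x\<in>{x \<in> X. N x \<le> 1}. cmod (f x))"

definition equivalent_norm ::
    "(complex \<Rightarrow> 'v::ab_group_add \<Rightarrow> 'v) \<Rightarrow> 'v set \<Rightarrow> ('v \<Rightarrow> real) \<Rightarrow> ('v \<Rightarrow> real) \<Rightarrow> bool" where
  "equivalent_norm sc X N N' \<longleftrightarrow>
     complex_normed_space sc X N' \<and>
     (\<exists>c>0. \<exists>C>0. \<forall>x\<in>X. c * N x \<le> N' x \<and> N' x \<le> C * N x)"

definition equivalent_dual_norm ::
    "(complex \<Rightarrow> 'v::ab_group_add \<Rightarrow> 'v) \<Rightarrow> 'v set \<Rightarrow> ('v \<Rightarrow> real) \<Rightarrow> (('v \<Rightarrow> complex) \<Rightarrow> real) \<Rightarrow> bool"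
  where
  "equivalent_dual_norm sc X N M \<longleftrightarrow>
     complex_normed_space (\<lambda>c f x. c * f x) (dual_space sc X N) M \<and>
     (\<exists>N'. equivalent_norm sc X N N' \<and>
           (\<forall>f \<in> dual_space sc X N. M f = dual_norm X N' f))"

definition locally_uniformly_rotund :: "'v::ab_group_add set \<Rightarrow> ('v \<Rightarrow> real) \<Rightarrow> bool" where
  "locally_uniformly_rotund X N \<longleftrightarrow>
     (\<forall>x\<in>X. \<forall>u::nat \<Rightarrow> 'v. range u \<subseteq> X \<longrightarrow>
        (\<lambda>n. N (u n)) \<longlonglongrightarrow> N x \<longrightarrow>
        (\<lambda>n. N (u n + x)) \<longlonglongrightarrow> 2 * N x \<longrightarrow>
        (\<lambda>n. N (u n - x)) \<longlonglongrightarrow> 0)"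

end

theory Submission imports Defs begin

text \<open>
  Discretise the \<open>K\<close>-method: \<open>B\<^bsub>\<theta>,p\<^esub>\<close> carries the equivalent norm
  \<open>N' a = inf (\<Sum>\<^sub>n (2\<^bsup>-\<theta>n\<^esup> \<parallel>x\<^sub>n\<parallel>\<^sub>0)\<^sup>p + (2\<^bsup>(1-\<theta>)n\<^esup> \<parallel>y\<^sub>n\<parallel>\<^sub>1)\<^sup>p)\<^bsup>1/p\<^esup>\<close> over all families of decompositions
  \<open>a = x\<^sub>n + y\<^sub>n\<close>, \<open>n \<in> \<int>\<close>. By the Hahn-Banach theorem every functional \<open>f\<close> lifts, with equality of
  norms, to a sequence \<open>h\<close> in the \<open>l\<^sup>q\<close> sum of the dual spaces. If \<open>\<parallel>f\<^sub>k\<parallel> \<rightarrow> \<parallel>f\<parallel>\<close> and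
  \<open>\<parallel>f\<^sub>k + f\<parallel> \<rightarrow> 2 \<parallel>f\<parallel>\<close>, strict convexity of \<open>t powr q\<close> transfers these limits to each coordinate of the
  lifts, so the \<open>B\<^sub>0\<^sup>*\<close> coordinates converge in norm by local uniform rotundity and the \<open>l\<^sup>q\<close> tails are
  uniformly small. The \<open>B\<^sub>1\<^sup>*\<close> coordinates are only bounded; but in evaluating \<open>(f\<^sub>k - f) a\<close> the decomposition
  of \<open>a\<close> at finitely many levels may be replaced by the one at a single level \<open>m\<close>, and the norm of its
  \<open>B\<^sub>1\<close> part is at most a multiple of \<open>2\<^bsup>-(1-\<theta>)m\<^esup>\<close>, which is small for large \<open>m\<close>.
\<close>

subsection \<open>Dual norms\<close>

text \<open>The renorming takes place on the predual: the dual norm of an equivalent norm is a dual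
  norm by construction, so only rotundity has to be proved. Optimal lifts are in general neither
  unique nor additive in \<open>f\<close>, so rotundity cannot be pulled back along a linear
  isometry. One inequality replaces it: the sum of a lift of \<open>f\<^sub>k\<close> and a lift of
  \<open>f\<close> is some lift of \<open>f\<^sub>k + f\<close>, hence has norm at least
  \<open>\<parallel>f\<^sub>k + f\<parallel>\<close>. The lifts therefore inherit the two limits in
  the \<open>l\<^sup>q\<close> sum. The obstacle is \<open>B1\<close>, about whose dual nothing is
  assumed. Passing to a high level \<open>m\<close> has a price: while the \<open>B1\<close> part
  shrinks, the bound on the \<open>B0\<close> part grows like \<open>2 powr (\<theta> * m)\<close>.
  The order of choices makes this harmless: first finitely many levels, then \<open>m\<close>, then
  \<open>k\<close>. Norm convergence in the dual of \<open>B0\<close> absorbs any factor fixed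
  before \<open>k\<close>.\<close>

lemma (in complex_normed_space)
  shows carrier_zero: "0 \<in> X"
    and carrier_add: "x \<in> X \<Longrightarrow> y \<in> X \<Longrightarrow> x + y \<in> X"
    and carrier_diff: "x \<in> X \<Longrightarrow> y \<in> X \<Longrightarrow> x - y \<in> X"
    and carrier_scale: "x \<in> X \<Longrightarrow> sc c x \<in> X"
  using subspace_carrier by (simp_all add: subspace_0 subspace_add subspace_diff subspace_scale)

lemma (in complex_normed_space) norm_zero [simp]: "N 0 = 0"
  using norm_eq_0 carrier_zero by blast

lemma (in complex_normed_space) bdd_above_dual_norm:
  assumes "f \<in> dual_space sc X N"
  shows "bdd_above ((\<lambda>x. cmod (f x)) ` {x \<in> X. N x \<le> 1})"
proof -
  from assms obtain C where C: "\<forall>x\<in>X. cmod (f x) \<le> C * N x"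
    by (auto simp: dual_space_def)
  have "cmod (f x) \<le> \<bar>C\<bar>" if "x \<in> X" "N x \<le> 1" for x
  proof -
    have "cmod (f x) \<le> C * N x" using C that by auto
    also have "\<dots> \<le> \<bar>C\<bar> * 1"
      by (intro mult_mono) (use that norm_nonneg in auto)
    finally show ?thesis by simp
  qed
  then show ?thesis by (auto intro!: bdd_aboveI)
qed

lemma (in complex_normed_space) dual_norm_nonneg:
  assumes "f \<in> dual_space sc X N"
  shows "0 \<le> dual_norm X N f"
proof -
  have "cmod (f 0) \<le> dual_norm X N f"
    unfolding dual_norm_def
    by (rule cSUP_upper[OF _ bdd_above_dual_norm[OF assms]])
       (use carrier_zero in auto)
  then show ?thesis using norm_ge_zero order_trans by blast
qed

lemma (in complex_normed_space) cmod_le_dual_norm: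
  assumes "f \<in> dual_space sc X N" "x \<in> X"
  shows "cmod (f x) \<le> dual_norm X N f * N x"
proof (cases "N x = 0")
  case True
  from assms obtain C where C: "\<forall>x\<in>X. cmod (f x) \<le> C * N x"
    by (auto simp: dual_space_def)
  with True assms(2) show ?thesis by fastforce
next
  case False
  then have pos: "N x > 0" using norm_nonneg assms(2) by fastforce
  let ?y = "sc (complex_of_real (1 / N x)) x"
  have y: "?y \<in> X" using assms(2) carrier_scale by blast
  have "N ?y = 1" using norm_scale[OF assms(2)] pos by (simp add: norm_divide)
  then have "cmod (f ?y) \<le> dual_norm X N f"
    unfolding dual_norm_def
    by (intro cSUP_upper[OF _ bdd_above_dual_norm[OF assms(1)]]) (use y in auto)
  moreover have "f ?y = complex_of_real (1 / N x) * f x"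
    using assms by (auto simp: dual_space_def)
  ultimately have "cmod (f x) / N x \<le> dual_norm X N f"
    using pos by (simp add: norm_mult norm_divide)
  then show ?thesis using pos by (simp add: field_simps)
qed

lemma (in complex_normed_space) dual_norm_le:
  assumes "\<And>x. x \<in> X \<Longrightarrow> N x \<le> 1 \<Longrightarrow> cmod (f x) \<le> C"
  shows "dual_norm X N f \<le> C"
  unfolding dual_norm_def
  by (rule cSUP_least) (use assms carrier_zero in auto)

lemma unimodular_multiple:
  obtains u where "cmod u = 1" "u * z = complex_of_real (cmod z)"
proof (cases "z = 0")
  case True
  then show thesis using that[of 1] by simp
next
  case False
  then show thesis using that[of "complex_of_real (cmod z) / z"] by (simp add: norm_divide)
qed

text \<open>Rotating a nearly norming vector makes its value real and positive. Values at different
  coordinates can then be added without cancellation when an extremal sequence is tested in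
  \<open>functional_representation\<close>.\<close>

lemma (in complex_normed_space) dual_norm_approx:
  assumes "f \<in> dual_space sc X N" "c < dual_norm X N f"
  obtains y r where "y \<in> X" "N y \<le> 1" "f y = complex_of_real r" "c < r"
proof -
  have "{x \<in> X. N x \<le> 1} \<noteq> {}" using carrier_zero by auto
  then obtain x where x: "x \<in> X" "N x \<le> 1" "c < cmod (f x)"
    using assms unfolding dual_norm_def less_cSUP_iff[OF \<open>_ \<noteq> {}\<close> bdd_above_dual_norm[OF assms(1)]]
    by auto
  obtain u where u: "cmod u = 1" "u * f x = complex_of_real (cmod (f x))"
    by (rule unimodular_multiple)
  show thesis
  proof
    show "sc u x \<in> X" using x carrier_scale by blast
    show "N (sc u x) \<le> 1" using x u norm_scale by simp
    show "f (sc u x) = complex_of_real (cmod (f x))"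
      using assms x u by (auto simp: dual_space_def)
  qed (rule x)
qed

lemma vector_space_fun: "vector_space (\<lambda>c (f::'a \<Rightarrow> complex) x. c * f x)"
  by unfold_locales (auto simp: fun_eq_iff algebra_simps)

lemma (in complex_normed_space) dual_space_add:
  assumes "f \<in> dual_space sc X N" "g \<in> dual_space sc X N"
  shows "f + g \<in> dual_space sc X N"
proof -
  from assms obtain C D where "\<forall>x\<in>X. cmod (f x) \<le> C * N x" "\<forall>x\<in>X. cmod (g x) \<le> D * N x"
    by (auto simp: dual_space_def)
  then have "\<forall>x\<in>X. cmod ((f + g) x) \<le> (C + D) * N x"
    by (auto simp: algebra_simps intro!: norm_triangle_mono)
  then have "\<exists>C. \<forall>x\<in>X. cmod ((f + g) x) \<le> C * N x" ..
  with assms show ?thesis by (auto simp: dual_space_def algebra_simps)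
qed

lemma (in complex_normed_space) dual_space_scale:
  assumes "f \<in> dual_space sc X N"
  shows "(\<lambda>x. c * f x) \<in> dual_space sc X N"
proof -
  from assms obtain C where "\<forall>x\<in>X. cmod (f x) \<le> C * N x"
    by (auto simp: dual_space_def)
  then have "\<forall>x\<in>X. cmod (c * f x) \<le> (cmod c * C) * N x"
    by (auto simp: norm_mult mult.assoc intro!: mult_left_mono)
  then have "\<exists>C. \<forall>x\<in>X. cmod (c * f x) \<le> C * N x" ..
  with assms show ?thesis by (auto simp: dual_space_def algebra_simps)
qed

lemma (in complex_normed_space) dual_space_diff:
  assumes "f \<in> dual_space sc X N" "g \<in> dual_space sc X N"
  shows "f - g \<in> dual_space sc X N"
proof -
  have "f - g = f + (\<lambda>x. (-1) * g x)" by (auto simp: fun_eq_iff)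
  then show ?thesis using dual_space_add[OF assms(1) dual_space_scale[OF assms(2)]] by metis
qed

lemma (in complex_normed_space) dual_norm_add_le:
  assumes "f \<in> dual_space sc X N" "g \<in> dual_space sc X N"
  shows "dual_norm X N (f + g) \<le> dual_norm X N f + dual_norm X N g"
proof (rule dual_norm_le)
  fix x assume x: "x \<in> X" "N x \<le> 1"
  have b: "cmod (h x) \<le> dual_norm X N h" if "h \<in> dual_space sc X N" for h
    using cmod_le_dual_norm[OF that x(1)] dual_norm_nonneg[OF that] x(2)
    by (smt (verit) mult_left_le)
  show "cmod ((f + g) x) \<le> dual_norm X N f + dual_norm X N g"
    using b[OF assms(1)] b[OF assms(2)] by (auto intro!: norm_triangle_mono)
qed

lemma (in complex_normed_space) complex_normed_space_dual:
  "complex_normed_space (\<lambda>c f x. c * f x) (dual_space sc X N) (dual_norm X N)"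
proof -
  interpret F: vector_space "\<lambda>c (f::'v \<Rightarrow> complex) x. c * f x" by (rule vector_space_fun)
  have zero: "0 \<in> dual_space sc X N" by (auto simp: dual_space_def intro!: exI[of _ 0])
  have scale_le: "dual_norm X N (\<lambda>x. c * f x) \<le> cmod c * dual_norm X N f"
    if f: "f \<in> dual_space sc X N" for c f
  proof (rule dual_norm_le)
    fix x assume x: "x \<in> X" "N x \<le> 1"
    have "cmod (f x) \<le> dual_norm X N f * N x" by (rule cmod_le_dual_norm[OF f x(1)])
    also have "\<dots> \<le> dual_norm X N f" using dual_norm_nonneg[OF f] x(2) by (simp add: mult_left_le)
    finally show "cmod (c * f x) \<le> cmod c * dual_norm X N f"
      by (simp add: norm_mult mult_left_mono)
  qed
  show ?thesis
  proof unfold_locales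
    show "F.subspace (dual_space sc X N)"
      using zero dual_space_add dual_space_scale by (auto intro!: F.subspaceI)
    fix f g :: "'v \<Rightarrow> complex" and c assume f: "f \<in> dual_space sc X N"
    show "0 \<le> dual_norm X N f" by (rule dual_norm_nonneg[OF f])
    show "dual_norm X N f = 0 \<longleftrightarrow> f = 0"
    proof
      assume "dual_norm X N f = 0"
      then have "f x = 0" for x
        using cmod_le_dual_norm[OF f, of x] f by (cases "x \<in> X") (auto simp: dual_space_def)
      then show "f = 0" by (auto simp: fun_eq_iff)
    next
      assume "f = 0"
      then have "dual_norm X N f \<le> 0" by (intro dual_norm_le) auto
      then show "dual_norm X N f = 0" using dual_norm_nonneg[OF f] by simp
    qed
    show "dual_norm X N (\<lambda>x. c * f x) = cmod c * dual_norm X N f"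
    proof (cases "c = 0")
      case True
      then have "dual_norm X N (\<lambda>x. c * f x) \<le> 0" by (intro dual_norm_le) auto
      then show ?thesis using True dual_norm_nonneg[OF dual_space_scale[OF f, of c]] by simp
    next
      case False
      \<comment> \<open>The reverse inequality is \<open>scale_le\<close> for the scalar
        \<open>1 / c\<close>, applied to the already scaled functional.\<close>
      have "dual_norm X N f \<le> cmod (1 / c) * dual_norm X N (\<lambda>x. c * f x)"
        using scale_le[OF dual_space_scale[OF f, of c], of "1 / c"] False by simp
      then have "cmod c * dual_norm X N f \<le> dual_norm X N (\<lambda>x. c * f x)"
        using False by (simp add: norm_divide field_simps)
      then show ?thesis using scale_le[OF f, of c] by simp
    qed
  next
    fix f g :: "'v \<Rightarrow> complex"
    assume "f \<in> dual_space sc X N" "g \<in> dual_space sc X N"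
    then show "dual_norm X N (f + g) \<le> dual_norm X N f + dual_norm X N g"
      by (rule dual_norm_add_le)
  qed
qed

subsection \<open>The Hahn-Banach theorem\<close>

text \<open>Zorn's lemma is applied to graphs of dominated real-linear functionals; that such a graph is
  single-valued follows from the domination, since \<open>(0, r)\<close> in the graph forces \<open>t * r \<le> 0\<close>
  for all real \<open>t\<close>.\<close>

lemma (in complex_normed_space) Hahn_Banach_real:
  fixes f :: "'v \<Rightarrow> real"
  assumes D: "D \<subseteq> X" "subspace D" and C: "0 \<le> C"
    and add: "\<And>x y. x \<in> D \<Longrightarrow> y \<in> D \<Longrightarrow> f (x + y) = f x + f y"
    and scale: "\<And>t x. x \<in> D \<Longrightarrow> f (sc (of_real t) x) = t * f x"
    and bound: "\<And>x. x \<in> D \<Longrightarrow> f x \<le> C * N x"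
  obtains F :: "'v \<Rightarrow> real" where
    "\<And>x y. x \<in> X \<Longrightarrow> y \<in> X \<Longrightarrow> F (x + y) = F x + F y"
    "\<And>t x. x \<in> X \<Longrightarrow> F (sc (of_real t) x) = t * F x"
    "\<And>x. x \<in> X \<Longrightarrow> F x \<le> C * N x"
    "\<And>x. x \<in> D \<Longrightarrow> F x = f x"
proof -
  define q where "q x = C * N x" for x
  have q_add: "q (x + y) \<le> q x + q y" if "x \<in> X" "y \<in> X" for x y
    using norm_triangle[OF that] C by (auto simp: q_def simp flip: distrib_left intro: mult_left_mono)
  have q_scale: "q (sc (of_real t) x) = \<bar>t\<bar> * q x" if "x \<in> X" for t x
    using norm_scale[OF that] by (simp add: q_def)
  define A where "A = {G :: ('v \<times> real) set.
      (\<forall>(x, r) \<in> G. x \<in> X \<and> r \<le> q x) \<and>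
      (\<forall>(x, r) \<in> G. \<forall>(y, s) \<in> G. (x + y, r + s) \<in> G) \<and>
      (\<forall>(x, r) \<in> G. \<forall>t. (sc (of_real t) x, t * r) \<in> G)}"
  define G0 where "G0 = (\<lambda>x. (x, f x)) ` D"
  have "G0 \<in> A"
    using D add scale bound subspace_add[OF D(2)] subspace_scale[OF D(2)]
    by (auto simp: A_def G0_def q_def image_iff)
  define AA where "AA = {G \<in> A. G0 \<subseteq> G}"
  have "AA \<noteq> {}" using \<open>G0 \<in> A\<close> by (auto simp: AA_def)
  moreover have "\<Union>\<C> \<in> AA" if "\<C> \<noteq> {}" and "subset.chain AA \<C>" for \<C>
  proof -
    have sub: "\<And>G. G \<in> \<C> \<Longrightarrow> G \<in> A" "\<And>G. G \<in> \<C> \<Longrightarrow> G0 \<subseteq> G"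
      using that(2) by (auto simp: subset_chain_def AA_def)
    have tot: "G \<subseteq> H \<or> H \<subseteq> G" if "G \<in> \<C>" "H \<in> \<C>" for G H
      using \<open>subset.chain AA \<C>\<close> that by (auto simp: subset_chain_def)
    have 1: "\<forall>(x, r) \<in> \<Union>\<C>. x \<in> X \<and> r \<le> q x" using sub(1) unfolding A_def by blast
    have 2: "\<forall>(x, r) \<in> \<Union>\<C>. \<forall>t. (sc (of_real t) x, t * r) \<in> \<Union>\<C>"
      using sub(1) unfolding A_def by blast
    have 3: "(x + y, r + s) \<in> \<Union>\<C>" if "(x, r) \<in> \<Union>\<C>" "(y, s) \<in> \<Union>\<C>" for x y r s
    proof -
      from that obtain G H where GH: "G \<in> \<C>" "H \<in> \<C>" "(x, r) \<in> G" "(y, s) \<in> H" by auto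
      then obtain K where "K \<in> \<C>" "(x, r) \<in> K" "(y, s) \<in> K" using tot[OF GH(1,2)] by blast
      then have "(x + y, r + s) \<in> K" using sub(1)[of K] unfolding A_def by blast
      with \<open>K \<in> \<C>\<close> show ?thesis by blast
    qed
    have "\<Union>\<C> \<in> A" unfolding A_def using 1 2 3 by blast
    moreover have "G0 \<subseteq> \<Union>\<C>" using that(1) sub(2) by blast
    ultimately show ?thesis by (simp add: AA_def)
  qed
  ultimately have "\<exists>M\<in>AA. \<forall>Y\<in>AA. M \<subseteq> Y \<longrightarrow> Y = M" by (rule subset_Zorn_nonempty)
  then obtain M where "M \<in> AA" and maxi: "\<And>G. G \<in> AA \<Longrightarrow> M \<subseteq> G \<Longrightarrow> G = M" by auto
  from \<open>M \<in> AA\<close> have "M \<in> A" "G0 \<subseteq> M" by (simp_all add: AA_def)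
  then have MX: "\<And>x r. (x, r) \<in> M \<Longrightarrow> x \<in> X" and Mq: "\<And>x r. (x, r) \<in> M \<Longrightarrow> r \<le> q x"
    and Madd: "\<And>x r y s. (x, r) \<in> M \<Longrightarrow> (y, s) \<in> M \<Longrightarrow> (x + y, r + s) \<in> M"
    and Mscale: "\<And>x r t. (x, r) \<in> M \<Longrightarrow> (sc (of_real t) x, t * r) \<in> M" and G0M: "G0 \<subseteq> M"
    unfolding A_def by blast+
  have M0: "(0, 0) \<in> M"
    using G0M subspace_0[OF D(2)] Mscale[of 0 "f 0" 0] by (auto simp: G0_def)
  have uniq: "r = s" if "(x, r) \<in> M" "(x, s) \<in> M" for x r s
  proof -
    have le: "r \<le> s" if "(x, r) \<in> M" "(x, s) \<in> M" for r s
    proof -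
      have "(x + sc (of_real (-1)) x, r + (-1) * s) \<in> M" by (intro Madd Mscale that)
      from Mq[OF this] show ?thesis by (simp add: q_def)
    qed
    show ?thesis using le[OF that] le[OF that(2,1)] by simp
  qed
  have total: "\<exists>r. (z, r) \<in> M" if z: "z \<in> X" for z
  proof (rule ccontr)
    assume nz: "\<nexists>r. (z, r) \<in> M"
    \<comment> \<open>A value at \<open>z\<close> must lie above every left side and below every
      right side in order to keep the domination. Subadditivity of \<open>q\<close> leaves room for
      it.\<close>
    have sep: "r - q (x - z) \<le> q (y + z) - s" if "(x, r) \<in> M" "(y, s) \<in> M" for x r y s
    proof -
      have "r + s \<le> q (x + y)" by (rule Mq[OF Madd[OF that]])
      also have "x + y = (x - z) + (y + z)" by simp
      also have "q \<dots> \<le> q (x - z) + q (y + z)"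
        by (intro q_add) (use carrier_add MX that z in \<open>auto intro: carrier_diff\<close>)
      finally show ?thesis by simp
    qed
    define c where "c = (SUP (x, r) \<in> M. r - q (x - z))"
    have bdd: "bdd_above ((\<lambda>(x, r). r - q (x - z)) ` M)"
      using sep[OF _ M0] by (intro bdd_aboveI[where M="q z"]) auto
    have c1: "r - q (x - z) \<le> c" if "(x, r) \<in> M" for x r
      unfolding c_def using cSUP_upper[OF that bdd] by simp
    have c2: "c \<le> q (y + z) - s" if "(y, s) \<in> M" for y s
      unfolding c_def by (rule cSUP_least) (use M0 sep that in auto)
    \<comment> \<open>By homogeneity the claim for \<open>t\<close> reduces to the coefficients 1
      and -1 of \<open>z\<close>, which are \<open>c2\<close> and \<open>c1\<close>.\<close>
    have key: "r + t * c \<le> q (x + sc (of_real t) z)" if "(x, r) \<in> M" for x r t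
    proof (cases t "0::real" rule: linorder_cases)
      case equal
      then show ?thesis using Mq[OF that] by simp
    next
      case greater
      have "(sc (of_real (1/t)) x, 1/t * r) \<in> M" by (rule Mscale[OF that])
      from c2[OF this] have "c + 1/t * r \<le> q (sc (of_real (1/t)) x + z)" by simp
      then have "t * (c + 1/t * r) \<le> t * q (sc (of_real (1/t)) x + z)"
        using greater by (intro mult_left_mono) auto
      also have "\<dots> = q (sc (of_real t) (sc (of_real (1/t)) x + z))"
        using greater q_scale[of "sc (of_real (1/t)) x + z" t] carrier_add carrier_scale MX[OF that] z by simp
      also have "sc (of_real t) (sc (of_real (1/t)) x + z) = x + sc (of_real t) z"
        using greater by (simp add: scale_right_distrib)
      also have "t * (c + 1/t * r) = r + t * c" using greater by (simp add: field_simps)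
      finally show ?thesis .
    next
      case less
      define u where "u = - t"
      then have u: "u > 0" using less by simp
      have "(sc (of_real (1/u)) x, 1/u * r) \<in> M" by (rule Mscale[OF that])
      from c1[OF this] have "1/u * r - c \<le> q (sc (of_real (1/u)) x - z)" by simp
      then have "u * (1/u * r - c) \<le> u * q (sc (of_real (1/u)) x - z)"
        using u by (intro mult_left_mono) auto
      also have "\<dots> = q (sc (of_real u) (sc (of_real (1/u)) x - z))"
        using u q_scale[of "sc (of_real (1/u)) x - z" u] carrier_diff
          carrier_scale MX[OF that] z by simp
      also have "sc (of_real u) (sc (of_real (1/u)) x - z) = x + sc (of_real t) z"
        using u by (simp add: scale_right_diff_distrib u_def)
      finally show ?thesis using u by (simp add: field_simps u_def)
    qed
    define G where "G = {(x + sc (of_real t) z, r + t * c) | x r t. (x, r) \<in> M}"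
    have GI: "(x + sc (of_real t) z, r + t * c) \<in> G" if "(x, r) \<in> M" for x r t
      using that by (auto simp: G_def)
    have "M \<subseteq> G"
    proof
      fix w assume "w \<in> M"
      moreover obtain x r where "w = (x, r)" by (cases w)
      ultimately show "w \<in> G" using GI[of x r 0] by simp
    qed
    have Gadd: "(x + y, r + s) \<in> G" if "(x, r) \<in> G" "(y, s) \<in> G" for x y r s
    proof -
      from that(1) obtain x' r' t where
        1: "(x', r') \<in> M" "x = x' + sc (of_real t) z" "r = r' + t * c"
        unfolding G_def by blast
      from that(2) obtain y' s' u where
        2: "(y', s') \<in> M" "y = y' + sc (of_real u) z" "s = s' + u * c"
        unfolding G_def by blast
      show ?thesis using GI[OF Madd[OF 1(1) 2(1)], of "t + u"] 1 2
        by (simp add: scale_left_distrib algebra_simps)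
    qed
    have Gscale: "(sc (of_real v) x, v * r) \<in> G" if "(x, r) \<in> G" for x r v
    proof -
      from that obtain x' r' t where
        *: "(x', r') \<in> M" "x = x' + sc (of_real t) z" "r = r' + t * c"
        unfolding G_def by blast
      then show ?thesis using GI[OF Mscale[OF *(1), of v], of "v * t"]
        by (simp add: scale_right_distrib algebra_simps)
    qed
    have GX: "x \<in> X \<and> r \<le> q x" if "(x, r) \<in> G" for x r
      using that key carrier_add carrier_scale MX z by (auto simp: G_def)
    have "G \<in> AA"
      unfolding AA_def A_def using Gadd Gscale GX G0M \<open>M \<subseteq> G\<close> by blast
    then have "G = M" using maxi \<open>M \<subseteq> G\<close> by blast
    moreover have "(z, c) \<in> G" using GI[OF M0, of 1] by simp
    ultimately show False using nz by blast
  qed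
  define F where "F x = (THE r. (x, r) \<in> M)" for x
  have F: "F x = r" if "(x, r) \<in> M" for x r
    unfolding F_def using that uniq by blast
  have FM: "(x, F x) \<in> M" if "x \<in> X" for x using total[OF that] F by auto
  show thesis
  proof
    fix x y assume "x \<in> X" "y \<in> X"
    then show "F (x + y) = F x + F y" using F Madd FM by blast
  next
    fix t x assume "x \<in> X"
    then show "F (sc (of_real t) x) = t * F x" using F Mscale FM by blast
  next
    fix x assume "x \<in> X"
    then show "F x \<le> C * N x" using Mq FM q_def by metis
  next
    fix x assume "x \<in> D"
    then show "F x = f x" using G0M F by (auto simp: G0_def)
  qed
qed

text \<open>A complex-linear functional is recovered from its real part \<open>g\<close> as
  \<open>g x - \<i> * g (sc \<i> x)\<close>, so it suffices to extend the real part. The constant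
  \<open>C\<close> survives because \<open>x\<close> can be rotated until \<open>F\<close> is real
  there, and then \<open>g\<close> gives the whole modulus.\<close>

lemma (in complex_normed_space) Hahn_Banach:
  fixes f :: "'v \<Rightarrow> complex"
  assumes D: "D \<subseteq> X" "subspace D" and C: "0 \<le> C"
    and add: "\<And>x y. x \<in> D \<Longrightarrow> y \<in> D \<Longrightarrow> f (x + y) = f x + f y"
    and scale: "\<And>c x. x \<in> D \<Longrightarrow> f (sc c x) = c * f x"
    and bound: "\<And>x. x \<in> D \<Longrightarrow> cmod (f x) \<le> C * N x"
  obtains F :: "'v \<Rightarrow> complex" where
    "\<And>x y. x \<in> X \<Longrightarrow> y \<in> X \<Longrightarrow> F (x + y) = F x + F y"
    "\<And>c x. x \<in> X \<Longrightarrow> F (sc c x) = c * F x"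
    "\<And>x. x \<in> X \<Longrightarrow> cmod (F x) \<le> C * N x"
    "\<And>x. x \<in> D \<Longrightarrow> F x = f x"
proof -
  obtain g :: "'v \<Rightarrow> real" where
    g: "\<And>x y. x \<in> X \<Longrightarrow> y \<in> X \<Longrightarrow> g (x + y) = g x + g y"
    "\<And>t x. x \<in> X \<Longrightarrow> g (sc (of_real t) x) = t * g x"
    "\<And>x. x \<in> X \<Longrightarrow> g x \<le> C * N x"
    "\<And>x. x \<in> D \<Longrightarrow> g x = Re (f x)"
  proof (rule Hahn_Banach_real[OF D C, of "\<lambda>x. Re (f x)"])
    fix x assume "x \<in> D"
    then show "Re (f x) \<le> C * N x" using bound complex_Re_le_cmod order_trans by blast
  qed (use add scale in auto)
  define F where "F x = Complex (g x) (- g (sc \<i> x))" for x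
  have F_add: "F (x + y) = F x + F y" if "x \<in> X" "y \<in> X" for x y
    using that g(1) carrier_scale by (simp add: F_def scale_right_distrib complex_eq_iff)
  have F_real: "F (sc (of_real t) x) = t * F x" if "x \<in> X" for t x
  proof -
    have "sc \<i> (sc (of_real t) x) = sc (of_real t) (sc \<i> x)" by (simp add: mult.commute)
    then show ?thesis using that g(2) carrier_scale by (simp add: F_def complex_eq_iff del: scale_scale)
  qed
  have F_i: "F (sc \<i> x) = \<i> * F x" if "x \<in> X" for x
    using g(2)[OF that, of "-1"] by (simp add: F_def complex_eq_iff)
  have F_scale: "F (sc c x) = c * F x" if x: "x \<in> X" for c x
  proof -
    have "sc c x = sc (of_real (Re c)) x + sc (of_real (Im c)) (sc \<i> x)"
      by (simp flip: scale_left_distrib) (simp add: complex_eq_iff)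
    then have "F (sc c x) = of_real (Re c) * F x + of_real (Im c) * (\<i> * F x)"
      using x carrier_scale by (simp add: F_add F_real F_i del: scale_scale)
    also have "\<dots> = c * F x" by (simp add: complex_eq_iff algebra_simps)
    finally show ?thesis .
  qed
  show thesis
  proof
    fix x assume x: "x \<in> X"
    obtain u where u: "cmod u = 1" "u * F x = complex_of_real (cmod (F x))"
      by (rule unimodular_multiple)
    have "F (sc u x) = complex_of_real (cmod (F x))" using F_scale[OF x] u by simp
    then have "cmod (F x) = g (sc u x)" by (simp add: F_def complex_eq_iff)
    also have "\<dots> \<le> C * N (sc u x)" using g(3) carrier_scale x by blast
    also have "\<dots> = C * N x" using norm_scale[OF x] u by simp
    finally show "cmod (F x) \<le> C * N x" .
  next
    fix x assume x: "x \<in> D"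
    then have "sc \<i> x \<in> D" using subspace_scale[OF D(2)] by blast
    then show "F x = f x" using g(4) x scale[OF x] by (simp add: F_def complex_eq_iff)
  qed (use F_add F_scale in auto)
qed

subsection \<open>Families in \<open>l\<^sup>p\<close>\<close>

text \<open>\<open>infsum\<close> is 0 on families that are not summable, so a bound on
  \<open>lp_norm\<close> says something only together with \<open>lp_summable\<close>. This is why
  the lemmas below carry both.\<close>

definition lp_summable :: "real \<Rightarrow> ('i \<Rightarrow> real) \<Rightarrow> bool" where
  "lp_summable p r \<longleftrightarrow> (\<lambda>i. r i powr p) summable_on UNIV"

definition lp_norm :: "real \<Rightarrow> ('i \<Rightarrow> real) \<Rightarrow> real" where
  "lp_norm p r = (\<Sum>\<^sub>\<infinity>i. r i powr p) powr (1 / p)"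

lemma lp_norm_nonneg: "0 \<le> lp_norm p r"
  by (simp add: lp_norm_def)

lemma lp_norm_powr:
  assumes "0 < p"
  shows "lp_norm p r powr p = (\<Sum>\<^sub>\<infinity>i. r i powr p)"
  using assms by (simp add: lp_norm_def powr_powr infsum_nonneg)

lemma lp_normI:
  assumes "0 < p" "0 \<le> R" "\<And>J. finite J \<Longrightarrow> (\<Sum>i\<in>J. r i powr p) \<le> R powr p"
  shows "lp_summable p r" "lp_norm p r \<le> R"
proof -
  show s: "lp_summable p r"
    unfolding lp_summable_def
    by (rule nonneg_bdd_above_summable_on) (use assms(3) in \<open>auto intro!: bdd_aboveI[of _ "R powr p"]\<close>)
  have "(\<Sum>\<^sub>\<infinity>i. r i powr p) \<le> R powr p"
    using s assms(3) unfolding lp_summable_def by (intro infsum_le_finite_sums) auto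
  then have "lp_norm p r \<le> (R powr p) powr (1 / p)"
    unfolding lp_norm_def using assms(1) by (intro powr_mono2) (auto intro: infsum_nonneg)
  then show "lp_norm p r \<le> R" using assms by (simp add: powr_powr)
qed

lemma sum_le_lp_norm_powr:
  assumes "0 < p" "lp_summable p r" "finite J"
  shows "(\<Sum>i\<in>J. r i powr p) \<le> lp_norm p r powr p"
  unfolding lp_norm_powr[OF assms(1)]
  by (rule finite_sum_le_infsum) (use assms in \<open>auto simp: lp_summable_def\<close>)

lemma le_lp_norm:
  assumes "0 < p" "lp_summable p r" "0 \<le> r i"
  shows "r i \<le> lp_norm p r"
proof -
  have "r i powr p \<le> lp_norm p r powr p"
    using sum_le_lp_norm_powr[OF assms(1,2), of "{i}"] by simp
  then have "(r i powr p) powr (1 / p) \<le> (lp_norm p r powr p) powr (1 / p)"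
    using assms(1) by (auto simp del: powr_powr intro: powr_mono2[of "1 / p"])
  then show ?thesis using assms by (simp add: powr_powr lp_norm_nonneg)
qed

lemma lp_norm_scale:
  assumes "0 < p" "0 \<le> c" "\<And>i. 0 \<le> r i" "lp_summable p r"
  shows "lp_summable p (\<lambda>i. c * r i)" "lp_norm p (\<lambda>i. c * r i) = c * lp_norm p r"
proof -
  have eq: "(c * r i) powr p = c powr p * r i powr p" for i
    using assms by (simp add: powr_mult)
  show "lp_summable p (\<lambda>i. c * r i)"
    using assms(4) unfolding lp_summable_def eq by (rule summable_on_cmult_right)
  have "(\<Sum>\<^sub>\<infinity>i. (c * r i) powr p) = c powr p * (\<Sum>\<^sub>\<infinity>i. r i powr p)"
    unfolding eq using infsum_cmult_right assms(4) unfolding lp_summable_def by blast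
  then show "lp_norm p (\<lambda>i. c * r i) = c * lp_norm p r"
    using assms(1,2) by (simp add: lp_norm_def powr_mult infsum_nonneg powr_powr)
qed

text \<open>If one of the points is 0, the claim reduces to \<open>s powr p \<le> s\<close> on the
  unit interval; convexity of the power is invoked for two positive points.\<close>

lemma powr_convex_combination:
  fixes a b t p :: real
  assumes "1 \<le> p" "0 \<le> a" "0 \<le> b" "0 \<le> t" "t \<le> 1"
  shows "(t * a + (1 - t) * b) powr p \<le> t * a powr p + (1 - t) * b powr p"
proof -
  have small: "s powr p \<le> s" if "0 \<le> s" "s \<le> 1" for s :: real
    using powr_mono'[of 1 p s] that assms(1) by simp
  consider "a = 0" | "b = 0" | "a > 0" "b > 0" using assms by linarith
  then show ?thesis
  proof cases
    case 1
    then show ?thesis using small[of "1 - t"] assms by (simp add: powr_mult mult_right_mono)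
  next
    case 2
    then show ?thesis using small[of t] assms by (simp add: powr_mult mult_right_mono)
  next
    case 3
    then show ?thesis
      using convex_onD[OF powr_convex[OF assms(1)], of "1 - t" a b] assms by simp
  qed
qed

text \<open>Minkowski's inequality by normalisation: after division by bounds \<open>A\<close> and
  \<open>B\<close> the sum becomes \<open>A + B\<close> times a convex combination with weights
  \<open>A / (A + B)\<close> and \<open>B / (A + B)\<close>, and convexity of the power is used
  termwise. A dominated family \<open>u\<close> in place of the sum covers the norms of vector sums
  as well as monotonicity.\<close>

lemma lp_norm_triangle:
  assumes p: "1 \<le> p" and r: "\<And>i. 0 \<le> r i" "lp_summable p r"
    and s: "\<And>i. 0 \<le> s i" "lp_summable p s"
    and u: "\<And>i. 0 \<le> u i" "\<And>i. u i \<le> r i + s i"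
  shows "lp_summable p u" "lp_norm p u \<le> lp_norm p r + lp_norm p s"
proof -
  have p0: "0 < p" using p by simp
  have *: "(\<Sum>i\<in>J. u i powr p) \<le> (lp_norm p r + lp_norm p s + e) powr p"
    if "0 < e" "finite J" for e J
  proof -
    \<comment> \<open>The extra \<open>e / 2\<close> keeps both divisors positive even if a norm
      vanishes.\<close>
    define A where "A = lp_norm p r + e / 2"
    define B where "B = lp_norm p s + e / 2"
    have AB: "A > 0" "B > 0" using that lp_norm_nonneg[of p r] lp_norm_nonneg[of p s]
      by (auto simp: A_def B_def)
    define t where "t = A / (A + B)"
    have t: "0 \<le> t" "t \<le> 1" and t': "1 - t = B / (A + B)" using AB by (auto simp: t_def field_simps)
    have part: "(\<Sum>i\<in>J. (x i / C) powr p) \<le> 1"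
      if "lp_summable p x" "\<And>i. 0 \<le> x i" "C > 0" "lp_norm p x \<le> C" for x C
    proof -
      have "(\<Sum>i\<in>J. (x i / C) powr p) = (\<Sum>i\<in>J. x i powr p) / C powr p"
        using that by (simp add: powr_divide sum_divide_distrib)
      also have "\<dots> \<le> lp_norm p x powr p / C powr p"
        using sum_le_lp_norm_powr[OF p0 that(1) \<open>finite J\<close>] by (simp add: divide_right_mono)
      also have "\<dots> \<le> 1"
        using that(3,4) p0 powr_mono2[of p "lp_norm p x" C] lp_norm_nonneg[of p x] by simp
      finally show ?thesis .
    qed
    have "u i powr p \<le> (A + B) powr p * (t * (r i / A) powr p + (1 - t) * (s i / B) powr p)" for i
    proof -
      have "u i powr p \<le> (r i + s i) powr p" using u p0 by (intro powr_mono2) auto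
      also have "r i + s i = (A + B) * (t * (r i / A) + (1 - t) * (s i / B))"
        unfolding t' unfolding t_def using AB by (simp add: distrib_left)
      also have "\<dots> powr p = (A + B) powr p * (t * (r i / A) + (1 - t) * (s i / B)) powr p"
        using AB t r(1)[of i] s(1)[of i] by (intro powr_mult) 
      also have "\<dots> \<le> (A + B) powr p * (t * (r i / A) powr p + (1 - t) * (s i / B) powr p)"
        using powr_convex_combination[OF p _ _ t, of "r i / A" "s i / B"] AB r(1)[of i] s(1)[of i]
        by (intro mult_left_mono) auto
      finally show ?thesis .
    qed
    then have "(\<Sum>i\<in>J. u i powr p)
        \<le> (\<Sum>i\<in>J. (A + B) powr p * (t * (r i / A) powr p + (1 - t) * (s i / B) powr p))"
      by (intro sum_mono)
    also have "\<dots> = (A + B) powr p * (t * (\<Sum>i\<in>J. (r i / A) powr p) + (1 - t) * (\<Sum>i\<in>J. (s i / B) powr p))"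
      by (simp only: sum_distrib_left sum.distrib distrib_left)
    also have "\<dots> \<le> (A + B) powr p * (t * 1 + (1 - t) * 1)"
      using part[OF r(2,1) AB(1)] part[OF s(2,1) AB(2)] t \<open>0 < e\<close>
      by (intro mult_left_mono add_mono) (auto simp: A_def B_def)
    finally show ?thesis by (simp add: A_def B_def algebra_simps)
  qed
  have n: "0 \<le> lp_norm p r + lp_norm p s + e" if "0 < e" for e
    using that lp_norm_nonneg[of p r] lp_norm_nonneg[of p s] by simp
  show "lp_summable p u" by (rule lp_normI(1)[OF p0 n[of 1] *[of 1]]) auto
  show "lp_norm p u \<le> lp_norm p r + lp_norm p s"
    by (rule field_le_epsilon) (rule lp_normI(2)[OF p0 n *])
qed

lemma lp_norm_mono:
  assumes "1 \<le> p" "\<And>i. 0 \<le> u i" "\<And>i. u i \<le> r i" "lp_summable p r"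
  shows "lp_summable p u" "lp_norm p u \<le> lp_norm p r"
proof -
  have "lp_summable p (\<lambda>i::'a. 0)" "lp_norm p (\<lambda>i::'a. 0) = 0" using assms(1)
    by (auto simp: lp_summable_def lp_norm_def)
  moreover have "0 \<le> r i" for i using assms(2,3)[of i] by simp
  ultimately show "lp_summable p u" "lp_norm p u \<le> lp_norm p r"
    using lp_norm_triangle[OF assms(1) _ assms(4), of "\<lambda>i. 0" u] assms(2,3) by simp_all
qed

text \<open>Young's inequality after both sums are normalised. Arbitrary bounds \<open>A\<close> and
  \<open>R\<close> over a finite \<open>J\<close>, instead of full norms, allow the use on tails,
  where the bound is much smaller than the norm.\<close>

lemma Holder_inequality_sum:
  fixes c r :: "'i \<Rightarrow> real"
  assumes pq: "1 < p" "1 < q" "1 / p + 1 / q = 1" and "finite J"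
    and c: "\<And>i. i \<in> J \<Longrightarrow> 0 \<le> c i" and r: "\<And>i. i \<in> J \<Longrightarrow> 0 \<le> r i"
    and A: "0 \<le> A" "(\<Sum>i\<in>J. c i powr q) \<le> A powr q"
    and R: "0 \<le> R" "(\<Sum>i\<in>J. r i powr p) \<le> R powr p"
  shows "(\<Sum>i\<in>J. c i * r i) \<le> A * R"
proof -
  have z: "x i = 0" if "(\<Sum>i\<in>J. x i powr s) \<le> 0 powr s" "i \<in> J" for x :: "'i \<Rightarrow> real" and s i
    using that \<open>finite J\<close> sum_nonneg_eq_0_iff[of J "\<lambda>i. x i powr s"]
    by (metis (no_types, lifting) order_antisym powr_eq_0_iff powr_ge_zero powr_zero_eq_one sum_nonneg zero_neq_one)
  consider "A = 0" | "R = 0" | "A > 0" "R > 0" using A R by linarith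
  then show ?thesis
  proof cases
    case 1
    then have "c i = 0" if "i \<in> J" for i using z[of c q i] A that by blast
    then show ?thesis using 1 by simp
  next
    case 2
    then have "r i = 0" if "i \<in> J" for i using z[of r p i] R that by blast
    then show ?thesis using 2 by simp
  next
    case 3
    have "(\<Sum>i\<in>J. c i * r i) = A * R * (\<Sum>i\<in>J. (r i / R) * (c i / A))"
      using 3 by (simp add: sum_distrib_left mult.commute)
    also have "\<dots> \<le> A * R * (\<Sum>i\<in>J. (r i / R) powr p / p + (c i / A) powr q / q)"
      using 3 pq c r by (intro mult_left_mono sum_mono Youngs_inequality) auto
    also have "(\<Sum>i\<in>J. (r i / R) powr p / p + (c i / A) powr q / q)
        = (\<Sum>i\<in>J. r i powr p) / R powr p / p + (\<Sum>i\<in>J. c i powr q) / A powr q / q"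
      using 3 c r by (simp add: sum.distrib powr_divide sum_divide_distrib)
    also have "\<dots> \<le> 1 / p + 1 / q"
      using 3 A R pq by (intro add_mono divide_right_mono) auto
    finally show ?thesis using 3 pq by simp
  qed
qed

text \<open>\<open>\<phi>\<close> is the convexity defect of the power between \<open>x\<close> and
  \<open>c\<close>; the factor \<open>2 powr (q - 1)\<close> is the one that makes it vanish at
  \<open>c\<close>. Its derivative has the sign of \<open>x - c\<close>, so \<open>c\<close> is its
  only zero and it stays away from 0 outside each neighbourhood of \<open>c\<close>. Since
  \<open>d k \<le> s k + c\<close>, the quantity assumed to tend to 0 dominates
  \<open>\<phi> (s k)\<close>.\<close>

lemma strict_convexity_powr:
  fixes c :: real and s d :: "nat \<Rightarrow> real"
  assumes q: "1 < q" and c: "0 \<le> c" and s: "\<And>k. 0 \<le> s k"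
    and d: "\<And>k. 0 \<le> d k" "\<And>k. d k \<le> s k + c"
    and lim: "(\<lambda>k. 2 powr (q - 1) * (s k powr q + c powr q) - d k powr q) \<longlonglongrightarrow> 0"
  shows "s \<longlonglongrightarrow> c" "d \<longlonglongrightarrow> 2 * c"
proof -
  define \<phi> where "\<phi> x = 2 powr (q - 1) * (x powr q + c powr q) - (x + c) powr q" for x
  have cont: "continuous_on {a..b} \<phi>" if "0 \<le> a" for a b
    unfolding \<phi>_def using that c q
    by (intro continuous_intros continuous_on_powr') auto
  have deriv: "(\<phi> has_real_derivative q * ((2 * x) powr (q - 1) - (x + c) powr (q - 1))) (at x)"
    if "0 < x" for x
    unfolding \<phi>_def
    by (rule derivative_eq_intros refl | use that c in \<open>simp add: algebra_simps powr_mult\<close>)+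
  have "\<phi> c = 0" using c by (simp add: \<phi>_def powr_diff powr_mult flip: mult_2)
  have dec: "\<phi> b < \<phi> a" if "0 \<le> a" "a < b" "b \<le> c" for a b
  proof (rule DERIV_neg_imp_decreasing_open[OF that(2) _ cont[OF that(1)]])
    fix x assume "a < x" "x < b"
    then show "\<exists>y. (\<phi> has_real_derivative y) (at x) \<and> y < 0"
      using that q deriv[of x] powr_less_mono2[of "q - 1" "2 * x" "x + c"]
      by (intro exI conjI) (auto simp: mult_less_0_iff)
  qed
  have inc: "\<phi> a < \<phi> b" if "c \<le> a" "a < b" for a b
  proof (rule DERIV_pos_imp_increasing_open[OF that(2) _ cont])
    fix x assume "a < x" "x < b"
    then show "\<exists>y. (\<phi> has_real_derivative y) (at x) \<and> 0 < y"
      using that q c deriv[of x] powr_less_mono2[of "q - 1" "x + c" "2 * x"]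
      by (intro exI conjI) (auto simp: zero_less_mult_iff)
  qed (use c that in simp)
  have \<phi>_nonneg: "0 \<le> \<phi> x" if "0 \<le> x" for x
    using dec[of x c] inc[of c x] that \<open>\<phi> c = 0\<close> c by (cases x c rule: linorder_cases) auto
  have gap: "d k powr q \<le> (s k + c) powr q" for k using d q by (intro powr_mono2) auto
  have "\<phi> (s k) \<le> 2 powr (q - 1) * (s k powr q + c powr q) - d k powr q" for k
    using gap by (simp add: \<phi>_def)
  then have \<phi>_lim: "(\<lambda>k. \<phi> (s k)) \<longlonglongrightarrow> 0"
    using \<phi>_nonneg s by (intro tendsto_sandwich[OF _ _ tendsto_const lim]) auto
  show s_lim: "s \<longlonglongrightarrow> c"
  proof (rule LIMSEQ_I)
    fix e :: real assume "0 < e"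
    \<comment> \<open>For \<open>e > c\<close> the point \<open>c - e\<close> is negative and out of
      reach of \<open>s k\<close>, so only the right-hand side counts.\<close>
    define m where "m = min (\<phi> (c + e)) (if e \<le> c then \<phi> (c - e) else \<phi> (c + e))"
    have "0 < m" unfolding m_def
      using inc[of c "c + e"] dec[of "c - e" c] \<open>0 < e\<close> c \<open>\<phi> c = 0\<close> by auto
    from order_tendstoD(2)[OF \<phi>_lim this] obtain n where n: "\<And>k. k \<ge> n \<Longrightarrow> \<phi> (s k) < m"
      by (auto simp: eventually_sequentially)
    have "norm (s k - c) < e" if "k \<ge> n" for k
    proof (rule ccontr)
      assume "\<not> norm (s k - c) < e"
      then consider "s k \<ge> c + e" | "s k \<le> c - e" "e \<le> c" using s[of k] by fastforce
      then have "\<phi> (s k) \<ge> m"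
      proof cases
        case 1
        then show ?thesis using inc[of "c + e" "s k"] \<open>0 < e\<close> by (fastforce simp: m_def)
      next
        case 2
        then show ?thesis using dec[of "s k" "c - e"] \<open>0 < e\<close> s[of k] by (fastforce simp: m_def)
      qed
      with n[OF that] show False by simp
    qed
    then show "\<exists>no. \<forall>k\<ge>no. norm (s k - c) < e" by blast
  qed
  have "(\<lambda>k. 2 powr (q - 1) * (s k powr q + c powr q)) \<longlonglongrightarrow> 2 powr (q - 1) * (c powr q + c powr q)"
    using q s by (intro tendsto_intros s_lim tendsto_powr') auto
  from tendsto_diff[OF this lim] have "(\<lambda>k. d k powr q) \<longlonglongrightarrow> (2 * c) powr q"
    using c by (simp add: powr_diff powr_mult flip: mult_2)
  then have "(\<lambda>k. (d k powr q) powr (1 / q)) \<longlonglongrightarrow> ((2 * c) powr q) powr (1 / q)"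
    by (rule tendsto_powr'[OF _ tendsto_const]) (use q in auto)
  then show "d \<longlonglongrightarrow> 2 * c" using d(1) c q by (simp add: powr_powr)
qed

subsection \<open>Sums of normed spaces in the sense of \<open>l\<^sup>p\<close>\<close>

definition lp_sum :: "real \<Rightarrow> ('i \<Rightarrow> 'v set) \<Rightarrow> ('i \<Rightarrow> 'v \<Rightarrow> real) \<Rightarrow> ('i \<Rightarrow> 'v) set" where
  "lp_sum p X N = {x. (\<forall>i. x i \<in> X i) \<and> lp_summable p (\<lambda>i. N i (x i))}"

definition lp_sum_norm :: "real \<Rightarrow> ('i \<Rightarrow> 'v \<Rightarrow> real) \<Rightarrow> ('i \<Rightarrow> 'v) \<Rightarrow> real" where
  "lp_sum_norm p N x = lp_norm p (\<lambda>i. N i (x i))"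

locale normed_family =
  fixes sc :: "complex \<Rightarrow> 'v::ab_group_add \<Rightarrow> 'v" and X :: "'i \<Rightarrow> 'v set" and N :: "'i \<Rightarrow> 'v \<Rightarrow> real"
    and p q :: real
  assumes normed: "\<And>i. complex_normed_space sc (X i) (N i)"
    and exponents: "1 < p" "1 < q" "1 / p + 1 / q = 1"
begin

abbreviation scf :: "complex \<Rightarrow> ('i \<Rightarrow> 'v) \<Rightarrow> 'i \<Rightarrow> 'v" where
  "scf \<equiv> \<lambda>c x i. sc c (x i)"

lemma vector_space_scf: "vector_space scf"
proof -
  \<comment> \<open>All members share the scalar multiplication \<open>sc\<close>, so any index
    supplies the vector space laws.\<close>
  interpret complex_normed_space sc "X undefined" "N undefined" by (rule normed)
  show ?thesis by unfold_locales (auto simp: fun_eq_iff scale_right_distrib scale_left_distrib)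
qed

lemmas N_nonneg = complex_normed_space.norm_nonneg[OF normed]
lemmas N_zero = complex_normed_space.norm_zero[OF normed]
lemmas zero_in = complex_normed_space.carrier_zero[OF normed]

lemma in_lp_sum: "x \<in> lp_sum p X N \<Longrightarrow> x i \<in> X i"
  by (simp add: lp_sum_def)

lemma lp_sum_summable: "x \<in> lp_sum p X N \<Longrightarrow> lp_summable p (\<lambda>i. N i (x i))"
  by (simp add: lp_sum_def)

lemma lp_sum_add:
  assumes "x \<in> lp_sum p X N" "y \<in> lp_sum p X N"
  shows "x + y \<in> lp_sum p X N" "lp_sum_norm p N (x + y) \<le> lp_sum_norm p N x + lp_sum_norm p N y"
proof -
  have XY: "x i \<in> X i" "y i \<in> X i" "x i + y i \<in> X i" for i
    using assms in_lp_sum complex_normed_space.carrier_add[OF normed] by blast+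
  note * = lp_norm_triangle[of p "\<lambda>i. N i (x i)" "\<lambda>i. N i (y i)" "\<lambda>i. N i ((x + y) i)"]
  show "x + y \<in> lp_sum p X N" "lp_sum_norm p N (x + y) \<le> lp_sum_norm p N x + lp_sum_norm p N y"
    using *(1,2) exponents XY assms[THEN lp_sum_summable] N_nonneg
      complex_normed_space.norm_triangle[OF normed]
    by (auto simp: lp_sum_def lp_sum_norm_def)
qed

lemma lp_sum_scale:
  assumes "x \<in> lp_sum p X N"
  shows "scf c x \<in> lp_sum p X N" "lp_sum_norm p N (scf c x) = cmod c * lp_sum_norm p N x"
proof -
  have p0: "0 < p" using exponents by simp
  have eq: "N i (sc c (x i)) = cmod c * N i (x i)" for i
    using complex_normed_space.norm_scale[OF normed in_lp_sum[OF assms]] .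
  note * = lp_norm_scale[OF p0 norm_ge_zero N_nonneg[OF in_lp_sum[OF assms]] lp_sum_summable[OF assms], of c]
  show "scf c x \<in> lp_sum p X N" "lp_sum_norm p N (scf c x) = cmod c * lp_sum_norm p N x"
    using * complex_normed_space.carrier_scale[OF normed in_lp_sum[OF assms]]
    by (auto simp: lp_sum_def lp_sum_norm_def eq)
qed

lemma complex_normed_space_lp_sum: "complex_normed_space scf (lp_sum p X N) (lp_sum_norm p N)"
proof -
  interpret F: vector_space scf by (rule vector_space_scf)
  have zero: "0 \<in> lp_sum p X N" "lp_sum_norm p N 0 = 0"
    using exponents zero_in N_zero
    by (auto simp: lp_sum_def lp_sum_norm_def lp_summable_def lp_norm_def)
  show ?thesis
  proof unfold_locales
    show "F.subspace (lp_sum p X N)"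
      using zero lp_sum_add lp_sum_scale by (auto intro!: F.subspaceI)
    fix x c assume x: "x \<in> lp_sum p X N"
    show "0 \<le> lp_sum_norm p N x" by (simp add: lp_sum_norm_def lp_norm_nonneg)
    show "lp_sum_norm p N x = 0 \<longleftrightarrow> x = 0"
    proof
      assume 0: "lp_sum_norm p N x = 0"
      show "x = 0"
      proof
        fix i
        have "N i (x i) \<le> 0"
          using le_lp_norm[OF _ lp_sum_summable[OF x], of i] exponents 0 N_nonneg[OF in_lp_sum[OF x]]
          by (simp add: lp_sum_norm_def)
        then have "N i (x i) = 0" using N_nonneg[OF in_lp_sum[OF x]] by (simp add: order_antisym)
        then show "x i = 0 i"
          using complex_normed_space.norm_eq_0[OF normed in_lp_sum[OF x]] by simp
      qed
    qed (use zero in simp)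
    show "lp_sum_norm p N (scf c x) = cmod c * lp_sum_norm p N x" by (rule lp_sum_scale[OF x])
  next
    fix x y assume "x \<in> lp_sum p X N" "y \<in> lp_sum p X N"
    then show "lp_sum_norm p N (x + y) \<le> lp_sum_norm p N x + lp_sum_norm p N y"
      by (rule lp_sum_add)
  qed
qed

lemma finite_pairing_le:
  assumes x: "\<And>i. i \<in> J \<Longrightarrow> x i \<in> X i" and h: "\<And>i. h i \<in> dual_space sc (X i) (N i)" and "finite J"
    and A: "0 \<le> A" "(\<Sum>i\<in>J. dual_norm (X i) (N i) (h i) powr q) \<le> A powr q"
    and R: "0 \<le> R" "(\<Sum>i\<in>J. N i (x i) powr p) \<le> R powr p"
  shows "cmod (\<Sum>i\<in>J. h i (x i)) \<le> A * R"
proof -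
  have "cmod (\<Sum>i\<in>J. h i (x i)) \<le> (\<Sum>i\<in>J. cmod (h i (x i)))" by (rule norm_sum)
  also have "\<dots> \<le> (\<Sum>i\<in>J. dual_norm (X i) (N i) (h i) * N i (x i))"
    by (intro sum_mono complex_normed_space.cmod_le_dual_norm[OF normed] h x)
  also have "\<dots> \<le> A * R"
    using exponents A R \<open>finite J\<close> complex_normed_space.dual_norm_nonneg[OF normed h] N_nonneg[OF x]
    by (intro Holder_inequality_sum[of p q]) auto
  finally show ?thesis .
qed

lemma pairing_le:
  assumes x: "x \<in> lp_sum p X N" and h: "\<And>i. h i \<in> dual_space sc (X i) (N i)"
    and hq: "lp_summable q (\<lambda>i. dual_norm (X i) (N i) (h i))"
    and s: "((\<lambda>i. h i (x i)) has_sum s) UNIV"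
  shows "cmod s \<le> lp_norm q (\<lambda>i. dual_norm (X i) (N i) (h i)) * lp_sum_norm p N x"
proof (rule tendsto_upperbound)
  show "((\<lambda>J. cmod (\<Sum>i\<in>J. h i (x i))) \<longlongrightarrow> cmod s) (finite_subsets_at_top UNIV)"
    using s unfolding has_sum_def by (rule tendsto_norm)
  show "\<forall>\<^sub>F J in finite_subsets_at_top UNIV. cmod (\<Sum>i\<in>J. h i (x i))
      \<le> lp_norm q (\<lambda>i. dual_norm (X i) (N i) (h i)) * lp_sum_norm p N x"
    using exponents sum_le_lp_norm_powr[OF _ hq] sum_le_lp_norm_powr[OF _ lp_sum_summable[OF x]]
    by (intro eventually_finite_subsets_at_top_weakI finite_pairing_le h in_lp_sum x)
       (auto simp: lp_sum_norm_def lp_norm_nonneg)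
qed simp

text \<open>The second part expresses the norm of a tail through a finite partial sum. Letting
  \<open>K\<close> grow shows that tails tend to 0 in norm, which yields the convergence in
  \<open>functional_representation\<close>.\<close>

lemma lp_sum_restrict:
  assumes x: "x \<in> lp_sum p X N"
  shows "(\<lambda>i. if i \<in> J then x i else 0) \<in> lp_sum p X N"
    and "finite K \<Longrightarrow> J = - K \<Longrightarrow>
      lp_sum_norm p N (\<lambda>i. if i \<in> J then x i else 0)
        = ((\<Sum>\<^sub>\<infinity>i. N i (x i) powr p) - (\<Sum>i\<in>K. N i (x i) powr p)) powr (1 / p)"
proof -
  have p: "1 \<le> p" using exponents by simp
  show "(\<lambda>i. if i \<in> J then x i else 0) \<in> lp_sum p X N"
    using lp_norm_mono(1)[OF p _ _ lp_sum_summable[OF x], of "\<lambda>i. N i (if i \<in> J then x i else 0)"]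
      in_lp_sum[OF x] N_nonneg[OF in_lp_sum[OF x]] zero_in N_zero by (auto simp: lp_sum_def)
  assume K: "finite K" "J = - K"
  have "(\<Sum>\<^sub>\<infinity>i. N i (if i \<in> J then x i else 0) powr p) = (\<Sum>\<^sub>\<infinity>i\<in>UNIV - K. N i (x i) powr p)"
    by (rule infsum_cong_neutral) (use K N_zero exponents in auto)
  also have "\<dots> = (\<Sum>\<^sub>\<infinity>i. N i (x i) powr p) - (\<Sum>\<^sub>\<infinity>i\<in>K. N i (x i) powr p)"
    using lp_sum_summable[OF x] K by (intro infsum_Diff) (auto simp: lp_summable_def)
  finally show "lp_sum_norm p N (\<lambda>i. if i \<in> J then x i else 0)
      = ((\<Sum>\<^sub>\<infinity>i. N i (x i) powr p) - (\<Sum>i\<in>K. N i (x i) powr p)) powr (1 / p)"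
    using K by (simp add: lp_sum_norm_def lp_norm_def)
qed

text \<open>Half of the duality between the \<open>l\<^sup>p\<close> sum and the
  \<open>l\<^sup>q\<close> sum of the duals, preceded by a Hahn-Banach extension from
  \<open>D\<close> to the whole sum. The coordinates \<open>h i\<close> are the restrictions of the
  extension to families with one nonzero entry. The series converges to \<open>f x\<close> because
  the error is the value of the extension at a tail of \<open>x\<close>.\<close>

lemma functional_representation:
  fixes f :: "('i \<Rightarrow> 'v) \<Rightarrow> complex"
  assumes D: "D \<subseteq> lp_sum p X N" "module.subspace scf D" and C: "0 \<le> C"
    and add: "\<And>x y. x \<in> D \<Longrightarrow> y \<in> D \<Longrightarrow> f (x + y) = f x + f y"
    and scale: "\<And>c x. x \<in> D \<Longrightarrow> f (scf c x) = c * f x"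
    and bound: "\<And>x. x \<in> D \<Longrightarrow> cmod (f x) \<le> C * lp_sum_norm p N x"
  obtains h where
    "\<And>i. h i \<in> dual_space sc (X i) (N i)"
    "lp_summable q (\<lambda>i. dual_norm (X i) (N i) (h i))"
    "lp_norm q (\<lambda>i. dual_norm (X i) (N i) (h i)) \<le> C"
    "\<And>x. x \<in> D \<Longrightarrow> ((\<lambda>i. h i (x i)) has_sum f x) UNIV"
proof -
  interpret W: complex_normed_space scf "lp_sum p X N" "lp_sum_norm p N"
    by (rule complex_normed_space_lp_sum)
  obtain F where
    F_add: "\<And>x y. x \<in> lp_sum p X N \<Longrightarrow> y \<in> lp_sum p X N \<Longrightarrow> F (x + y) = F x + F y" and
    F_scale: "\<And>c x. x \<in> lp_sum p X N \<Longrightarrow> F (scf c x) = c * F x" and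
    F_le: "\<And>x. x \<in> lp_sum p X N \<Longrightarrow> cmod (F x) \<le> C * lp_sum_norm p N x" and
    F_eq: "\<And>x. x \<in> D \<Longrightarrow> F x = f x"
    by (rule W.Hahn_Banach[OF D C, of f]) (rule add scale bound that; assumption)+
  have pq: "0 < p" "0 < q" "p \<noteq> 0" "q \<noteq> 0" using exponents by auto
  have F_0: "F 0 = 0" using F_scale[OF W.carrier_zero, of 0] unfolding W.scale_zero_left by simp
  define single :: "'i \<Rightarrow> 'v \<Rightarrow> 'i \<Rightarrow> 'v" where "single i y = (\<lambda>j. if j = i then y else 0)" for i y
  have restrict: "(\<lambda>i. if i \<in> J then x i else 0) \<in> lp_sum p X N \<and>
      lp_sum_norm p N (\<lambda>i. if i \<in> J then x i else 0) = (\<Sum>i\<in>J. N i (x i) powr p) powr (1 / p)"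
    if "finite J" "\<And>i. i \<in> J \<Longrightarrow> x i \<in> X i" for J x
  proof -
    have "((\<lambda>i. N i (if i \<in> J then x i else 0) powr p) has_sum (\<Sum>i\<in>J. N i (x i) powr p)) UNIV"
      by (rule has_sum_finite_neutralI[OF that(1)]) (use N_zero pq in auto)
    then show ?thesis
      using that zero_in by (auto simp: lp_sum_def lp_sum_norm_def lp_norm_def lp_summable_def
          infsumI has_sum_imp_summable)
  qed
  have single: "single i y \<in> lp_sum p X N" "lp_sum_norm p N (single i y) = N i y" if "y \<in> X i" for i y
    using restrict[of "{i}" "\<lambda>_. y"] that N_nonneg[OF that] pq by (auto simp: single_def powr_powr)
  define h where "h i y = (if y \<in> X i then F (single i y) else 0)" for i y
  have h: "h i \<in> dual_space sc (X i) (N i)" for i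
  proof -
    interpret complex_normed_space sc "X i" "N i" by (rule normed)
    have "F (single i (x + y)) = F (single i x) + F (single i y)" if "x \<in> X i" "y \<in> X i" for x y
    proof -
      have "single i (x + y) = single i x + single i y" by (auto simp: single_def fun_eq_iff)
      then show ?thesis using F_add single that by metis
    qed
    moreover have "F (single i (sc c x)) = c * F (single i x)" if "x \<in> X i" for c x
    proof -
      have "single i (sc c x) = scf c (single i x)" by (auto simp: single_def fun_eq_iff)
      then show ?thesis using F_scale single that by metis
    qed
    moreover have "cmod (h i x) \<le> C * N i x" if "x \<in> X i" for x
      using F_le[OF single(1)[OF that]] single(2)[OF that] that by (simp add: h_def)
    ultimately show ?thesis
      by (auto simp: dual_space_def h_def carrier_add carrier_scale intro!: exI[of _ C])
  qed
  have F_finite: "F (\<lambda>i. if i \<in> J then x i else 0) = (\<Sum>i\<in>J. h i (x i))"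
    if "finite J" "\<And>i. i \<in> J \<Longrightarrow> x i \<in> X i" for J x
    using that
  proof (induction J)
    case empty
    then show ?case using F_0 by (simp add: zero_fun_def)
  next
    case (insert j J)
    have "(\<lambda>i. if i \<in> insert j J then x i else 0) = single j (x j) + (\<lambda>i. if i \<in> J then x i else 0)"
      using insert.hyps by (auto simp: single_def fun_eq_iff)
    then show ?case
      using insert F_add[OF single(1) restrict[THEN conjunct1]] by (simp add: h_def)
  qed
  let ?d = "\<lambda>i. dual_norm (X i) (N i) (h i)"
  have d_nonneg: "0 \<le> ?d i" for i by (rule complex_normed_space.dual_norm_nonneg[OF normed h])
  text \<open>Testing against the extremal sequence \<open>c\<^sub>i powr (q - 1)\<close> of \<open>l\<^sup>p\<close>.\<close>
  have lower: "(\<Sum>i\<in>J. c i powr q) \<le> C powr q"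
    if "finite J" and c: "\<And>i. i \<in> J \<Longrightarrow> 0 \<le> c i \<and> c i < ?d i" for J c
  proof -
    have "\<exists>y r. y \<in> X i \<and> N i y \<le> 1 \<and> h i y = complex_of_real r \<and> c i < r" if "i \<in> J" for i
      using complex_normed_space.dual_norm_approx[OF normed h, of "c i" i] c[OF that] by metis
    then obtain y r where y: "\<And>i. i \<in> J \<Longrightarrow> y i \<in> X i" "\<And>i. i \<in> J \<Longrightarrow> N i (y i) \<le> 1"
      "\<And>i. i \<in> J \<Longrightarrow> h i (y i) = complex_of_real (r i)" "\<And>i. i \<in> J \<Longrightarrow> c i < r i"
      by metis
    define x where "x i = sc (of_real (c i powr (q - 1))) (y i)" for i
    define S where "S = (\<Sum>i\<in>J. c i powr q)"
    have "S \<ge> 0" by (simp add: S_def sum_nonneg)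
    have x: "x i \<in> X i" if "i \<in> J" for i
      using y(1)[OF that] complex_normed_space.carrier_scale[OF normed] by (simp add: x_def)
    \<comment> \<open>This identity turns the \<open>p\<close>-th powers of the test sequence into
      the \<open>q\<close>-th powers of \<open>c\<close>, so both sides of the test involve the same
      sum \<open>S\<close>.\<close>
    have conj: "(q - 1) * p = q" using exponents by (auto simp: field_simps)
    have "N i (x i) powr p \<le> c i powr q" if "i \<in> J" for i
    proof -
      have "N i (x i) \<le> c i powr (q - 1)"
        using complex_normed_space.norm_scale[OF normed y(1)[OF that]] y(2)[OF that]
        by (simp add: x_def mult_left_le)
      then have "N i (x i) powr p \<le> (c i powr (q - 1)) powr p"
        using N_nonneg[OF x[OF that]] pq by (intro powr_mono2) auto
      then show ?thesis by (simp add: powr_powr conj)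
    qed
    then have "(\<Sum>i\<in>J. N i (x i) powr p) powr (1 / p) \<le> S powr (1 / p)"
      unfolding S_def using pq by (intro powr_mono2 sum_mono sum_nonneg) auto
    then have upper: "cmod (\<Sum>i\<in>J. h i (x i)) \<le> C * S powr (1 / p)"
      using F_le[OF restrict[OF \<open>finite J\<close> x, THEN conjunct1]] restrict[OF \<open>finite J\<close> x] C
        F_finite[OF \<open>finite J\<close> x] by (simp add: mult_left_mono order_trans)
    have "h i (x i) = complex_of_real (c i powr (q - 1) * r i)" if "i \<in> J" for i
      using h[of i] y(1,3)[OF that] by (simp add: dual_space_def x_def)
    then have "(\<Sum>i\<in>J. h i (x i)) = complex_of_real (\<Sum>i\<in>J. c i powr (q - 1) * r i)" by simp
    moreover have "S \<le> (\<Sum>i\<in>J. c i powr (q - 1) * r i)"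
      unfolding S_def
    proof (rule sum_mono)
      fix i assume i: "i \<in> J"
      have "c i powr q = c i powr (q - 1) * c i" using c[OF i] pq by (cases "c i = 0") (auto simp: powr_diff)
      also have "\<dots> \<le> c i powr (q - 1) * r i" using y(4)[OF i] by (intro mult_left_mono) auto
      finally show "c i powr q \<le> c i powr (q - 1) * r i" .
    qed
    ultimately have S: "S \<le> C * S powr (1 / p)" using upper by (smt (verit) norm_of_real abs_ge_self)
    show ?thesis
    proof (cases "S = 0")
      case False
      then have "S > 0" using \<open>S \<ge> 0\<close> by simp
      have "1 / q = 1 - 1 / p" using exponents by simp
      then have "S powr (1 / q) = S / S powr (1 / p)" using \<open>S > 0\<close> by (simp add: powr_diff)
      also have "\<dots> \<le> C" using S \<open>S > 0\<close> by (simp add: field_simps)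
      finally have "(S powr (1 / q)) powr q \<le> C powr q" using pq by (intro powr_mono2) auto
      then show ?thesis using \<open>S > 0\<close> pq by (simp add: powr_powr S_def)
    qed (simp add: S_def)
  qed
  \<comment> \<open>The dual norms need not be attained, so \<open>lower\<close> requires strictly
    smaller numbers. Multiples \<open>t * ?d i\<close> with \<open>t < 1\<close> are admissible
    wherever \<open>?d i\<close> is nonzero, and \<open>t\<close> then tends to 1.\<close>
  have d_le: "(\<Sum>i\<in>J. ?d i powr q) \<le> C powr q" if "finite J" for J
  proof (rule tendsto_upperbound)
    have "((\<lambda>t. \<Sum>i\<in>J. (t * ?d i) powr q) \<longlongrightarrow> (\<Sum>i\<in>J. (1 * ?d i) powr q)) (at_left 1)"
      using pq d_nonneg
      by (intro tendsto_sum tendsto_powr' tendsto_mult tendsto_const tendsto_ident_at) auto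
    then show "((\<lambda>t. \<Sum>i\<in>J. (t * ?d i) powr q) \<longlongrightarrow> (\<Sum>i\<in>J. ?d i powr q)) (at_left 1)"
      by simp
    show "\<forall>\<^sub>F t in at_left 1. (\<Sum>i\<in>J. (t * ?d i) powr q) \<le> C powr q"
    proof (rule eventually_at_leftI[of 0])
      fix t :: real assume t: "t \<in> {0<..<1}"
      have "(\<Sum>i\<in>J. (t * ?d i) powr q) = (\<Sum>i\<in>{i\<in>J. ?d i \<noteq> 0}. (t * ?d i) powr q)"
        using that by (intro sum.mono_neutral_right) auto
      also have "\<dots> \<le> C powr q"
        using that t d_nonneg by (intro lower) (auto simp: less_le)
      finally show "(\<Sum>i\<in>J. (t * ?d i) powr q) \<le> C powr q" .
    qed simp
  qed simp
  show thesis
  proof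
    show "h i \<in> dual_space sc (X i) (N i)" for i by (rule h)
    show "lp_summable q ?d" "lp_norm q ?d \<le> C" using lp_normI[OF pq(2) C d_le] by auto
    fix x assume x: "x \<in> D"
    then have xW: "x \<in> lp_sum p X N" using D by blast
    let ?S = "\<Sum>\<^sub>\<infinity>i. N i (x i) powr p"
    have est: "cmod ((\<Sum>i\<in>J. h i (x i)) - f x) \<le> C * (?S - (\<Sum>i\<in>J. N i (x i) powr p)) powr (1 / p)"
      if "finite J" for J
    proof -
      let ?y = "\<lambda>i. if i \<in> - J then x i else 0"
      have "x = (\<lambda>i. if i \<in> J then x i else 0) + ?y" by (auto simp: fun_eq_iff)
      then have "F x = F (\<lambda>i. if i \<in> J then x i else 0) + F ?y"
        using F_add lp_sum_restrict(1)[OF xW] by metis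
      then have "(\<Sum>i\<in>J. h i (x i)) - f x = - F ?y"
        using F_finite[OF that in_lp_sum[OF xW]] F_eq[OF x] by simp
      then show ?thesis
        using F_le[OF lp_sum_restrict(1)[OF xW, of "- J"]] lp_sum_restrict(2)[OF xW that refl]
        by (simp only: norm_minus_cancel)
    qed
    have "((\<lambda>i. N i (x i) powr p) has_sum ?S) UNIV"
      using lp_sum_summable[OF xW] by (simp add: lp_summable_def)
    then have "((\<lambda>J. C * (?S - (\<Sum>i\<in>J. N i (x i) powr p)) powr (1 / p)) \<longlongrightarrow> C * (?S - ?S) powr (1 / p))
        (finite_subsets_at_top UNIV)"
      unfolding has_sum_def using lp_sum_summable[OF xW] pq
      by (intro tendsto_intros tendsto_powr' eventually_finite_subsets_at_top_weakI)
         (auto simp: lp_summable_def intro!: finite_sum_le_infsum eventually_finite_subsets_at_top_weakI)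
    then have lim: "((\<lambda>J. C * (?S - (\<Sum>i\<in>J. N i (x i) powr p)) powr (1 / p)) \<longlongrightarrow> 0)
        (finite_subsets_at_top UNIV)" by simp
    show "((\<lambda>i. h i (x i)) has_sum f x) UNIV"
      unfolding has_sum_def
      by (rule Lim_null_comparison[OF _ lim, THEN Lim_null[THEN iffD2]])
         (use est in \<open>auto intro!: eventually_finite_subsets_at_top_weakI\<close>)
  qed
qed

end

subsection \<open>The discrete \<open>K\<close>-method\<close>

text \<open>A weight leaves the set of bounded functionals alone and divides the dual norm by a
  constant. The rotundity hypothesis on the dual of \<open>B0\<close> thereby passes to every
  weighted copy of \<open>B0\<close>.\<close>

lemma (in complex_normed_space) scaled_norm:
  assumes "0 < w"
  shows "complex_normed_space sc X (\<lambda>x. w * N x)"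
    and "dual_space sc X (\<lambda>x. w * N x) = dual_space sc X N"
    and "f \<in> dual_space sc X N \<Longrightarrow> dual_norm X (\<lambda>x. w * N x) f = dual_norm X N f / w"
proof -
  show w: "complex_normed_space sc X (\<lambda>x. w * N x)"
  proof unfold_locales
    fix x y assume "x \<in> X" "y \<in> X"
    from norm_triangle[OF this] show "w * N (x + y) \<le> w * N x + w * N y"
      using assms by (simp flip: distrib_left)
  qed (use assms subspace_carrier norm_nonneg norm_eq_0 norm_scale in auto)
  have "(\<exists>C. \<forall>x\<in>X. cmod (f x) \<le> C * (w * N x)) \<longleftrightarrow> (\<exists>C. \<forall>x\<in>X. cmod (f x) \<le> C * N x)" for f
  proof
    assume "\<exists>C. \<forall>x\<in>X. cmod (f x) \<le> C * N x"
    then obtain C where "\<forall>x\<in>X. cmod (f x) \<le> C * N x" ..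
    then have "\<forall>x\<in>X. cmod (f x) \<le> (C / w) * (w * N x)" using assms by simp
    then show "\<exists>C. \<forall>x\<in>X. cmod (f x) \<le> C * (w * N x)" ..
  qed (metis mult.assoc)
  then show eq: "dual_space sc X (\<lambda>x. w * N x) = dual_space sc X N"
    by (simp add: dual_space_def)
  assume f: "f \<in> dual_space sc X N"
  interpret w: complex_normed_space sc X "\<lambda>x. w * N x" by (rule w)
  show "dual_norm X (\<lambda>x. w * N x) f = dual_norm X N f / w"
  proof (rule antisym)
    show "dual_norm X (\<lambda>x. w * N x) f \<le> dual_norm X N f / w"
    proof (rule w.dual_norm_le)
      fix x assume x: "x \<in> X" "w * N x \<le> 1"
      have "cmod (f x) \<le> dual_norm X N f * N x" by (rule cmod_le_dual_norm[OF f x(1)])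
      also have "\<dots> \<le> dual_norm X N f * (1 / w)"
        using x(2) assms dual_norm_nonneg[OF f] by (intro mult_left_mono) (auto simp: field_simps)
      finally show "cmod (f x) \<le> dual_norm X N f / w" by simp
    qed
    have f': "f \<in> dual_space sc X (\<lambda>x. w * N x)" using f eq by simp
    have "dual_norm X N f \<le> w * dual_norm X (\<lambda>x. w * N x) f"
    proof (rule dual_norm_le)
      fix x assume x: "x \<in> X" "N x \<le> 1"
      have "cmod (f x) \<le> dual_norm X (\<lambda>x. w * N x) f * (w * N x)"
        by (rule w.cmod_le_dual_norm[OF f' x(1)])
      also have "\<dots> \<le> dual_norm X (\<lambda>x. w * N x) f * (w * 1)"
        using x(2) assms w.dual_norm_nonneg[OF f'] by (intro mult_left_mono) auto
      finally show "cmod (f x) \<le> w * dual_norm X (\<lambda>x. w * N x) f" by (simp add: mult.commute)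
    qed
    then show "dual_norm X N f / w \<le> dual_norm X (\<lambda>x. w * N x) f"
      using assms by (simp add: field_simps)
  qed
qed

text \<open>Continuity of the two inclusions and of addition at \<open>(0, 0)\<close> puts
  \<open>a\<close> into every neighbourhood of 0, which contradicts the Hausdorff separation of
  \<open>a\<close> from 0. Definiteness of \<open>interp_norm\<close> and positivity of the
  \<open>K\<close>-functional both rest on this.\<close>

lemma (in interpolation_couple) small_decompositions_imp_zero:
  assumes "\<And>e. 0 < e \<Longrightarrow> \<exists>a0\<in>B0. \<exists>a1\<in>B1. a = a0 + a1 \<and> N0 a0 < e \<and> N1 a1 < e"
  shows "a = 0"
proof (rule ccontr)
  assume "a \<noteq> 0"
  then obtain U V where UV: "open U" "open V" "0 \<in> U" "a \<in> V" "U \<inter> V = {}"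
    using hausdorff[of 0 a] by auto
  have "continuous_on UNIV (\<lambda>x::'e \<times> 'e. fst x + snd x)" by (intro continuous_intros)
  then have "isCont (\<lambda>x::'e \<times> 'e. fst x + snd x) (0, 0)"
    by (simp add: continuous_on_eq_continuous_at)
  then have "\<exists>S. open S \<and> (0, 0) \<in> S \<and> (\<forall>x\<in>S. fst x + snd x \<in> U)"
    using UV by (auto simp: continuous_at_open)
  then obtain S where S: "open S" "((0, 0) :: 'e \<times> 'e) \<in> S" "\<And>x. x \<in> S \<Longrightarrow> fst x + snd x \<in> U" by auto
  from open_prod_elim[OF S(1,2)] obtain P Q
    where "open P" "open Q" "((0, 0) :: 'e \<times> 'e) \<in> P \<times> Q" "P \<times> Q \<subseteq> S" by metis
  then have PQ: "open P" "open Q" "0 \<in> P" "0 \<in> Q" "P \<times> Q \<subseteq> S" by auto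
  have small: "\<exists>d>0. \<forall>y\<in>B. N y < d \<longrightarrow> y \<in> P"
    if "continuously_included B N" "0 \<in> B" "open P" "0 \<in> P" for B N and P :: "'e set"
    using that(1)[unfolded continuously_included_def, rule_format, OF that(2), of P] that(3,4) by simp
  obtain d0 where d0: "d0 > 0" "\<And>y. y \<in> B0 \<Longrightarrow> N0 y < d0 \<Longrightarrow> y \<in> P"
    using small[OF included_B0 B0.carrier_zero PQ(1,3)] by blast
  obtain d1 where d1: "d1 > 0" "\<And>y. y \<in> B1 \<Longrightarrow> N1 y < d1 \<Longrightarrow> y \<in> Q"
    using small[OF included_B1 B1.carrier_zero PQ(2,4)] by blast
  obtain a0 a1 where "a0 \<in> B0" "a1 \<in> B1" "a = a0 + a1" "N0 a0 < min d0 d1" "N1 a1 < min d0 d1"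
    using assms[of "min d0 d1"] d0(1) d1(1) by auto
  then have "(a0, a1) \<in> S" using d0(2) d1(2) PQ(5) by auto
  then have "a \<in> U" using S(3)[of "(a0, a1)"] \<open>a = a0 + a1\<close> by simp
  then show False using UV by auto
qed

locale real_interpolation = interpolation_couple sc B0 N0 B1 N1
  for sc :: "complex \<Rightarrow> 'e::{topological_ab_group_add, t2_space} \<Rightarrow> 'e" and B0 N0 B1 N1 +
  fixes \<theta> p q :: real
  assumes theta: "0 < \<theta>" "\<theta> < 1" and pq: "1 < p" "1 < q" "1 / p + 1 / q = 1"
begin

text \<open>A discrete version of the \<open>K\<close>-method: \<open>x (n, False) + x (n, True)\<close> is a decomposition at
  \<open>t = 2 powr n\<close>, with \<open>False\<close> and \<open>True\<close> marking the components in \<open>B0\<close> and \<open>B1\<close>. Taking an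
  \<open>l\<^sup>p\<close> combination also of the two components is what makes the dual norm see \<open>B0\<^sup>*\<close> separately.\<close>

definition Xs :: "int \<times> bool \<Rightarrow> 'e set" where
  "Xs i = (if snd i then B1 else B0)"

text \<open>At \<open>t = 2 powr n\<close> these are \<open>t powr (- \<theta>)\<close> times the
  factors 1 and \<open>t\<close> that the \<open>K\<close>-functional puts on the two
  components.\<close>

definition weight :: "int \<times> bool \<Rightarrow> real" where
  "weight i = (if snd i then 2 powr ((1 - \<theta>) * fst i) else 2 powr (- \<theta> * fst i))"

definition Ns :: "int \<times> bool \<Rightarrow> 'e \<Rightarrow> real" where
  "Ns i x = weight i * (if snd i then N1 x else N0 x)"

definition decomp :: "'e \<Rightarrow> (int \<times> bool \<Rightarrow> 'e) set" where
  "decomp a = {x \<in> lp_sum p Xs Ns. \<forall>n. x (n, False) + x (n, True) = a}"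

definition interp_space :: "'e set" where
  "interp_space = {a. decomp a \<noteq> {}}"

definition interp_norm :: "'e \<Rightarrow> real" where
  "interp_norm a = Inf (lp_sum_norm p Ns ` decomp a)"

lemma weight_pos: "0 < weight i"
  by (simp add: weight_def)

lemma normed_Xs: "complex_normed_space sc (Xs i) (Ns i)"
  using B0.scaled_norm(1)[OF weight_pos[of i]] B1.scaled_norm(1)[OF weight_pos[of i]]
  by (cases "snd i") (simp_all add: Xs_def Ns_def[abs_def])

sublocale fam: normed_family sc Xs Ns p q
  by (intro normed_family.intro normed_Xs pq)

lemma decomp_in: "x \<in> decomp a \<Longrightarrow> x \<in> lp_sum p Xs Ns"
  by (simp add: decomp_def)

lemma decomp_add: "x \<in> decomp a \<Longrightarrow> y \<in> decomp b \<Longrightarrow> x + y \<in> decomp (a + b)"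
  using fam.lp_sum_add(1)[of x y] by (auto simp: decomp_def algebra_simps)

lemma decomp_scale: "x \<in> decomp a \<Longrightarrow> (\<lambda>i. sc c (x i)) \<in> decomp (sc c a)"
  using fam.lp_sum_scale(1)[of x c] by (auto simp: decomp_def simp flip: scale_right_distrib)

lemma interp_norm_le: "x \<in> decomp a \<Longrightarrow> interp_norm a \<le> lp_sum_norm p Ns x"
  unfolding interp_norm_def
  by (rule cInf_lower) (auto simp: lp_sum_norm_def lp_norm_nonneg intro!: bdd_belowI[of _ 0])

lemma interp_norm_approx:
  assumes "a \<in> interp_space" "interp_norm a < R"
  obtains x where "x \<in> decomp a" "lp_sum_norm p Ns x < R"
proof -
  have "lp_sum_norm p Ns ` decomp a \<noteq> {}" using assms(1) by (auto simp: interp_space_def)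
  from cInf_lessD[OF this assms(2)[unfolded interp_norm_def]] that show thesis by auto
qed

lemma interp_norm_nonneg: "a \<in> interp_space \<Longrightarrow> 0 \<le> interp_norm a"
  unfolding interp_norm_def interp_space_def
  by (rule cInf_greatest) (auto simp: lp_sum_norm_def lp_norm_nonneg)

lemma component_le:
  assumes "x \<in> decomp a"
  shows "x (n, False) \<in> B0" "weight (n, False) * N0 (x (n, False)) \<le> lp_sum_norm p Ns x"
    "x (n, True) \<in> B1" "weight (n, True) * N1 (x (n, True)) \<le> lp_sum_norm p Ns x"
proof -
  have x: "x i \<in> Xs i" for i by (rule fam.in_lp_sum[OF decomp_in[OF assms]])
  show "x (n, False) \<in> B0" "x (n, True) \<in> B1"
    using x[of "(n, False)"] x[of "(n, True)"] by (simp_all add: Xs_def)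
  have "Ns i (x i) \<le> lp_sum_norm p Ns x" for i
    unfolding lp_sum_norm_def
    using le_lp_norm[OF _ fam.lp_sum_summable[OF decomp_in[OF assms]], of i] fam.N_nonneg[OF x] pq by simp
  from this[of "(n, False)"] this[of "(n, True)"]
  show "weight (n, False) * N0 (x (n, False)) \<le> lp_sum_norm p Ns x"
    "weight (n, True) * N1 (x (n, True)) \<le> lp_sum_norm p Ns x"
    by (simp_all add: Ns_def)
qed

lemma interp_space_add: "a \<in> interp_space \<Longrightarrow> b \<in> interp_space \<Longrightarrow> a + b \<in> interp_space"
  using decomp_add unfolding interp_space_def by blast

lemma interp_space_scale: "a \<in> interp_space \<Longrightarrow> sc c a \<in> interp_space"
  using decomp_scale unfolding interp_space_def by blast

lemma interp_norm_scale_le: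
  assumes a: "a \<in> interp_space" 
  shows "interp_norm (sc c a) \<le> cmod c * interp_norm a"
proof (rule field_le_epsilon)
  fix e :: real assume e: "0 < e"
  \<comment> \<open>Adding 1 to \<open>cmod c\<close> covers the scalar 0 as well.\<close>
  have "interp_norm a < interp_norm a + e / (cmod c + 1)"
    using e by (simp add: add_nonneg_pos)
  then obtain x where x: "x \<in> decomp a" "lp_sum_norm p Ns x < interp_norm a + e / (cmod c + 1)"
    by (rule interp_norm_approx[OF a])
  have "interp_norm (sc c a) \<le> cmod c * lp_sum_norm p Ns x"
    using interp_norm_le[OF decomp_scale[OF x(1)]] fam.lp_sum_scale(2)[OF decomp_in[OF x(1)]] by simp
  also have "\<dots> \<le> cmod c * (interp_norm a + e / (cmod c + 1))"
    using x by (intro mult_left_mono) auto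
  also have "\<dots> = cmod c * interp_norm a + e * (cmod c / (cmod c + 1))"
    by (simp add: algebra_simps)
  also have "\<dots> \<le> cmod c * interp_norm a + e"
    using e by (intro add_left_mono mult_left_le) (auto simp: add_nonneg_pos)
  finally show "interp_norm (sc c a) \<le> cmod c * interp_norm a + e" .
qed

lemma zero_decomp: "0 \<in> decomp 0" "interp_norm 0 = 0"
proof -
  interpret W: complex_normed_space fam.scf "lp_sum p Xs Ns" "lp_sum_norm p Ns"
    by (rule fam.complex_normed_space_lp_sum)
  show 0: "0 \<in> decomp 0" using W.carrier_zero by (simp add: decomp_def)
  then have "0 \<in> interp_space" by (auto simp: interp_space_def)
  then show "interp_norm 0 = 0"
    using interp_norm_le[OF 0] interp_norm_nonneg by (simp add: order_antisym)
qed

lemma complex_normed_space_interp: "complex_normed_space sc interp_space interp_norm"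
proof unfold_locales
  show "subspace interp_space"
    using zero_decomp interp_space_add interp_space_scale
    by (intro subspaceI) (auto simp: interp_space_def)
  fix a c assume a: "a \<in> interp_space"
  show "0 \<le> interp_norm a" by (rule interp_norm_nonneg[OF a])
  show "interp_norm (sc c a) = cmod c * interp_norm a"
  proof (cases "c = 0")
    case True
    then show ?thesis using zero_decomp by simp
  next
    case False
    have "interp_norm a \<le> cmod (1 / c) * interp_norm (sc c a)"
      using interp_norm_scale_le[OF interp_space_scale[OF a, of c], of "1 / c"] False by simp
    then have "cmod c * interp_norm a \<le> interp_norm (sc c a)"
      using False by (simp add: norm_divide field_simps)
    then show ?thesis using interp_norm_scale_le[OF a, of c] by simp
  qed
  show "interp_norm a = 0 \<longleftrightarrow> a = 0"
  proof
    assume 0: "interp_norm a = 0"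
    show "a = 0"
    proof (rule small_decompositions_imp_zero)
      fix e :: real assume "0 < e"
      then have "interp_norm a < e" using 0 by simp
      then obtain x where x: "x \<in> decomp a" "lp_sum_norm p Ns x < e"
        by (rule interp_norm_approx[OF a])
      \<comment> \<open>At level 0 both weights are 1, so a family of small norm splits
        \<open>a\<close> there into two unweighted small parts.\<close>
      have "weight (0, b) = 1" for b by (simp add: weight_def)
      then show "\<exists>a0\<in>B0. \<exists>a1\<in>B1. a = a0 + a1 \<and> N0 a0 < e \<and> N1 a1 < e"
        using component_le[OF x(1), of 0] x
        by (intro bexI[of _ "x (0, False)"] bexI[of _ "x (0, True)"]) (auto simp: decomp_def)
    qed
  qed (use zero_decomp in simp)
next
  fix a b assume a: "a \<in> interp_space" and b: "b \<in> interp_space"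
  show "interp_norm (a + b) \<le> interp_norm a + interp_norm b"
  proof (rule field_le_epsilon)
    fix e :: real assume "0 < e"
    then have e: "interp_norm c < interp_norm c + e / 2" for c by simp
    obtain x where x: "x \<in> decomp a" "lp_sum_norm p Ns x < interp_norm a + e / 2"
      by (rule interp_norm_approx[OF a e])
    obtain y where y: "y \<in> decomp b" "lp_sum_norm p Ns y < interp_norm b + e / 2"
      by (rule interp_norm_approx[OF b e])
    have "interp_norm (a + b) \<le> lp_sum_norm p Ns x + lp_sum_norm p Ns y"
      using interp_norm_le[OF decomp_add[OF x(1) y(1)]]
        fam.lp_sum_add(2)[OF decomp_in[OF x(1)] decomp_in[OF y(1)]] by simp
    then show "interp_norm (a + b) \<le> interp_norm a + interp_norm b + e" using x y by simp
  qed
qed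

sublocale I: complex_normed_space sc interp_space interp_norm
  by (rule complex_normed_space_interp)

section \<open>Norm-preserving lifts of functionals to the \<open>l\<^sup>q\<close> sum of the
  duals\<close>

abbreviation dn :: "(int \<times> bool \<Rightarrow> 'e \<Rightarrow> complex) \<Rightarrow> int \<times> bool \<Rightarrow> real" where
  "dn h i \<equiv> dual_norm (Xs i) (Ns i) (h i)"

text \<open>The formula is demanded for every admissible decomposition of \<open>a\<close>. This
  freedom is what later permits evaluating a lift at a decomposition rearranged to suit the
  estimate.\<close>

definition represents :: "(int \<times> bool \<Rightarrow> 'e \<Rightarrow> complex) \<Rightarrow> ('e \<Rightarrow> complex) \<Rightarrow> bool" where
  "represents h f \<longleftrightarrow> (\<forall>i. h i \<in> dual_space sc (Xs i) (Ns i)) \<and> lp_summable q (dn h) \<and>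
     (\<forall>a. \<forall>x\<in>decomp a. ((\<lambda>i. h i (x i)) has_sum f a) UNIV)"

lemma representsD:
  assumes "represents h f"
  shows "h i \<in> dual_space sc (Xs i) (Ns i)" "lp_summable q (dn h)"
    "x \<in> decomp a \<Longrightarrow> ((\<lambda>i. h i (x i)) has_sum f a) UNIV" "0 \<le> dn h i"
proof -
  show "h i \<in> dual_space sc (Xs i) (Ns i)" using assms unfolding represents_def by blast
  then show "0 \<le> dn h i" by (rule complex_normed_space.dual_norm_nonneg[OF normed_Xs])
qed (use assms in \<open>simp_all add: represents_def\<close>)

text \<open>Pairing a lift with nearly optimal decompositions gives the bound. Together with
  \<open>exists_representation\<close> it makes the dual norm the minimum of the norms of the
  lifts.\<close>

lemma dual_norm_le_represents:
  assumes "represents h f"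
  shows "dual_norm interp_space interp_norm f \<le> lp_norm q (dn h)"
proof (rule I.dual_norm_le)
  fix a assume a: "a \<in> interp_space" "interp_norm a \<le> 1"
  let ?L = "lp_norm q (dn h)"
  have "cmod (f a) \<le> ?L * (1 + e)" if "0 < e" for e
  proof -
    from a(2) that have "interp_norm a < 1 + e" by simp
    then obtain x where x: "x \<in> decomp a" "lp_sum_norm p Ns x < 1 + e"
      by (rule interp_norm_approx[OF a(1)])
    have "cmod (f a) \<le> ?L * lp_sum_norm p Ns x"
      by (rule fam.pairing_le[OF decomp_in[OF x(1)] representsD(1,2)[OF assms] representsD(3)[OF assms x(1)]])
    also have "\<dots> \<le> ?L * (1 + e)" using x by (intro mult_left_mono) (auto simp: lp_norm_nonneg)
    finally show ?thesis .
  qed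
  moreover have "((\<lambda>e. ?L * (1 + e)) \<longlongrightarrow> ?L * (1 + 0)) (at_right 0)" by (intro tendsto_intros)
  ultimately show "cmod (f a) \<le> ?L"
    by (intro tendsto_lowerbound[of "\<lambda>e. ?L * (1 + e)" ?L "at_right 0"])
       (auto simp: eventually_at_filter)
qed

lemma exists_representation:
  assumes f: "f \<in> dual_space sc interp_space interp_norm"
  obtains h where "represents h f" "lp_norm q (dn h) = dual_norm interp_space interp_norm f"
proof -
  interpret W: complex_normed_space fam.scf "lp_sum p Xs Ns" "lp_sum_norm p Ns"
    by (rule fam.complex_normed_space_lp_sum)
  \<comment> \<open>The choice of level 0 is arbitrary: on \<open>D\<close> all levels of
    \<open>x\<close> have the same sum, so \<open>?T\<close> recovers the element that
    \<open>x\<close> decomposes.\<close>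
  let ?T = "\<lambda>x::int \<times> bool \<Rightarrow> 'e. x (0, False) + x (0, True)"
  let ?C = "dual_norm interp_space interp_norm f"
  define D where "D = (\<Union>a. decomp a)"
  have T: "?T x = a" if "x \<in> decomp a" for x a using that by (auto simp: decomp_def)
  have f_add: "f (a + b) = f a + f b" if "a \<in> interp_space" "b \<in> interp_space" for a b
    using f that by (simp add: dual_space_def)
  have f_scale: "f (sc c a) = c * f a" if "a \<in> interp_space" for a c
    using f that by (simp add: dual_space_def)
  have space: "a \<in> interp_space" if "x \<in> decomp a" for x a using that by (auto simp: interp_space_def)
  obtain h where h: "\<And>i. h i \<in> dual_space sc (Xs i) (Ns i)" "lp_summable q (dn h)" "lp_norm q (dn h) \<le> ?C"
    "\<And>x. x \<in> D \<Longrightarrow> ((\<lambda>i. h i (x i)) has_sum f (?T x)) UNIV"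
  proof (rule fam.functional_representation[of D ?C "\<lambda>x. f (?T x)"])
    show "D \<subseteq> lp_sum p Xs Ns" by (auto simp: D_def decomp_in)
    show "W.subspace D"
    proof (rule W.subspaceI)
      show "0 \<in> D" using zero_decomp(1) unfolding D_def by blast
      fix x c assume "x \<in> D"
      then obtain a where a: "x \<in> decomp a" by (auto simp: D_def)
      from decomp_scale[OF a] show "fam.scf c x \<in> D" unfolding D_def by blast
      show "x + y \<in> D" if "y \<in> D" for y
      proof -
        from that obtain b where b: "y \<in> decomp b" by (auto simp: D_def)
        from decomp_add[OF a b] show ?thesis unfolding D_def by blast
      qed
    qed
    show "0 \<le> ?C" by (rule I.dual_norm_nonneg[OF f])
    fix x assume "x \<in> D"
    then obtain a where a: "x \<in> decomp a" by (auto simp: D_def)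
    show "f (?T (fam.scf c x)) = c * f (?T x)" for c
      using f_scale[OF space[OF a]] T[OF a] T[OF decomp_scale[OF a]] by simp
    show "f (?T (x + y)) = f (?T x) + f (?T y)" if y: "y \<in> D" for y
    proof -
      from y obtain b where b: "y \<in> decomp b" by (auto simp: D_def)
      show ?thesis using f_add[OF space[OF a] space[OF b]] T[OF a] T[OF b] T[OF decomp_add[OF a b]] by simp
    qed
    have "cmod (f a) \<le> ?C * interp_norm a" by (rule I.cmod_le_dual_norm[OF f space[OF a]])
    also have "\<dots> \<le> ?C * lp_sum_norm p Ns x"
      using interp_norm_le[OF a] I.dual_norm_nonneg[OF f] by (intro mult_left_mono)
    finally show "cmod (f (?T x)) \<le> ?C * lp_sum_norm p Ns x" using T[OF a] by simp
  qed (rule that)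
  have "((\<lambda>i. h i (x i)) has_sum f a) UNIV" if "x \<in> decomp a" for x a
    using h(4)[of x] that T[OF that] unfolding D_def by auto
  then have "represents h f" using h(1,2) by (simp add: represents_def)
  moreover from dual_norm_le_represents[OF this] h(3) have "lp_norm q (dn h) = ?C" by simp
  ultimately show thesis by (rule that)
qed

text \<open>The sum of two optimal lifts need not be optimal, but it is a lift, and that suffices
  for the lower bound on its norm by \<open>dual_norm_le_represents\<close>.\<close>

lemma represents_add:
  assumes "represents h f" "represents g f'"
  shows "represents (\<lambda>i. h i + g i) (f + f')"
    and "dn (\<lambda>i. h i + g i) i \<le> dn h i + dn g i"
proof -
  note h = representsD[OF assms(1)] and g = representsD[OF assms(2)]
  have hg: "h i + g i \<in> dual_space sc (Xs i) (Ns i)" for i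
    by (rule complex_normed_space.dual_space_add[OF normed_Xs h(1) g(1)])
  show le: "dn (\<lambda>i. h i + g i) i \<le> dn h i + dn g i" for i
    by (rule complex_normed_space.dual_norm_add_le[OF normed_Xs h(1) g(1)])
  have "lp_summable q (dn (\<lambda>i. h i + g i))"
    by (rule lp_norm_triangle(1)[OF _ h(4,2) g(4,2) _ le])
       (use pq complex_normed_space.dual_norm_nonneg[OF normed_Xs hg] in auto)
  moreover have "((\<lambda>i. (h i + g i) (x i)) has_sum (f + f') a) UNIV" if "x \<in> decomp a" for x a
    using has_sum_add[OF h(3)[OF that] g(3)[OF that]] by simp
  ultimately show "represents (\<lambda>i. h i + g i) (f + f')"
    unfolding represents_def using hg by blast
qed

subsection \<open>Local uniform rotundity\<close>

text \<open>The coordinate defects \<open>E k i\<close> are nonnegative by convexity, and their sum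
  over \<open>i\<close> is at most \<open>G k\<close>, because \<open>H k + h\<close> lifts
  \<open>u k + f\<close>. As \<open>G k\<close> tends to 0, each defect does, and
  \<open>strict_convexity_powr\<close> applies at each coordinate.\<close>

lemma coordinate_limits:
  assumes f: "f \<in> dual_space sc interp_space interp_norm" and u: "\<And>k. u k \<in> dual_space sc interp_space interp_norm"
    and h: "represents h f" "lp_norm q (dn h) = dual_norm interp_space interp_norm f"
    and H: "\<And>k. represents (H k) (u k)" "\<And>k. lp_norm q (dn (H k)) = dual_norm interp_space interp_norm (u k)"
    and lim: "(\<lambda>k. dual_norm interp_space interp_norm (u k)) \<longlonglongrightarrow> dual_norm interp_space interp_norm f"
      "(\<lambda>k. dual_norm interp_space interp_norm (u k + f)) \<longlonglongrightarrow> 2 * dual_norm interp_space interp_norm f"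
  shows "(\<lambda>k::nat. dn (H k) i) \<longlonglongrightarrow> dn h i" "(\<lambda>k. dn (\<lambda>i. H k i + h i) i) \<longlonglongrightarrow> 2 * dn h i"
proof -
  let ?M = "dual_norm interp_space interp_norm"
  let ?d = "\<lambda>k i. dn (\<lambda>i. H k i + h i) i"
  have q: "0 < q" "1 < q" using pq by auto
  have M_nonneg: "0 \<le> ?M f" "0 \<le> ?M (u k)" for k
    using h(2) H(2) lp_norm_nonneg by metis+
  have M_nonneg_add: "0 \<le> ?M (u k + f)" for k
    by (rule I.dual_norm_nonneg[OF I.dual_space_add[OF u f]])
  note s = representsD[OF H(1)] and c = representsD[OF h(1)]
  note d = representsD[OF represents_add(1)[OF H(1) h(1)]]
  have d_le: "?d k i \<le> dn (H k) i + dn h i" for k i by (rule represents_add(2)[OF H(1) h(1)])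
  have has_sum_powr: "((\<lambda>i. dn g i powr q) has_sum (lp_norm q (dn g) powr q)) UNIV"
    if "lp_summable q (dn g)" for g
    using that unfolding lp_norm_powr[OF q(1)] lp_summable_def by simp
  define E where "E k i = 2 powr (q - 1) * (dn (H k) i powr q + dn h i powr q) - ?d k i powr q" for k i
  define G where "G k = 2 powr (q - 1) * (?M (u k) powr q + ?M f powr q) - ?M (u k + f) powr q" for k
  have E_nonneg: "0 \<le> E k i" for k i
  proof -
    have "?d k i powr q \<le> (dn (H k) i + dn h i) powr q"
      using d(4) d_le q by (intro powr_mono2) auto
    also have "\<dots> = (1/2 * (2 * dn (H k) i) + (1 - 1/2) * (2 * dn h i)) powr q" by simp
    also have "\<dots> \<le> 1/2 * (2 * dn (H k) i) powr q + (1 - 1/2) * (2 * dn h i) powr q"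
      using s(4) c(4) q by (intro powr_convex_combination) auto
    also have "\<dots> = 2 powr (q - 1) * (dn (H k) i powr q + dn h i powr q)"
      using s(4) c(4) by (simp add: powr_mult powr_diff algebra_simps)
    finally show ?thesis by (simp add: E_def)
  qed
  have E_le: "E k i \<le> G k" for k i
  proof -
    have "((\<lambda>i. - (?d k i powr q)) has_sum - (lp_norm q (?d k) powr q)) UNIV"
      using has_sum_powr[OF d(2)] has_sum_uminus by force
    from has_sum_add[OF has_sum_cmult_right[OF has_sum_add[OF has_sum_powr[OF s(2)] has_sum_powr[OF c(2)]],
        of "2 powr (q - 1)"] this]
    have "(E k has_sum (2 powr (q - 1) * (?M (u k) powr q + ?M f powr q) - lp_norm q (?d k) powr q)) UNIV"
      using h(2) H(2) by (simp add: E_def[abs_def])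
    from finite_sum_le_has_sum[OF this, of "{i}"] E_nonneg
    have "E k i \<le> 2 powr (q - 1) * (?M (u k) powr q + ?M f powr q) - lp_norm q (?d k) powr q" by simp
    moreover have "?M (u k + f) powr q \<le> lp_norm q (?d k) powr q"
    proof (rule powr_mono2)
      show "0 \<le> ?M (u k + f)" by (rule M_nonneg_add)
    next
      show "?M (u k + f) \<le> lp_norm q (?d k)"
        by (rule dual_norm_le_represents[OF represents_add(1)[OF H(1) h(1)]])
    qed (use q in simp)
    ultimately show ?thesis by (simp add: G_def)
  qed
  have "G \<longlonglongrightarrow> 2 powr (q - 1) * (?M f powr q + ?M f powr q) - (2 * ?M f) powr q"
    unfolding G_def using q M_nonneg
    by (intro tendsto_intros tendsto_powr' lim) (use M_nonneg_add in auto)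
  then have G: "G \<longlonglongrightarrow> 0" using M_nonneg by (simp add: powr_mult powr_diff)
  have "(\<lambda>k. E k i) \<longlonglongrightarrow> 0"
    by (rule tendsto_sandwich[OF _ _ tendsto_const G]) (use E_nonneg E_le in auto)
  then show "(\<lambda>k. dn (H k) i) \<longlonglongrightarrow> dn h i" "(\<lambda>k. ?d k i) \<longlonglongrightarrow> 2 * dn h i"
    using strict_convexity_powr[OF q(2) c(4) s(4) d(4) d_le] unfolding E_def by auto
qed

text \<open>Changing finitely many levels preserves summability. The norm of the new family is not
  controlled and may be large; the tail estimates below use the norm of \<open>x\<close>, with which
  it agrees off \<open>J\<close>.\<close>

lemma decomp_shift:
  assumes x: "x \<in> decomp a" and "finite J"
  shows "(\<lambda>(n, b). if n \<in> J then x (m, b) else x (n, b)) \<in> decomp a"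
proof -
  define y where "y = (\<lambda>(n, b). if n \<in> J then x (m, b) else x (n, b))"
  have y_in: "y i \<in> Xs i" for i
    using component_le(1,3)[OF x] by (cases i; cases "snd i") (auto simp: y_def Xs_def)
  have "(\<lambda>i. Ns i (y i) powr p) summable_on (J \<times> UNIV) \<union> (UNIV - J \<times> UNIV)"
  proof (rule summable_on_Un_disjoint)
    show "(\<lambda>i. Ns i (y i) powr p) summable_on J \<times> UNIV"
      using \<open>finite J\<close> by (intro summable_on_finite) auto
    have "(\<lambda>i. Ns i (x i) powr p) summable_on (UNIV - J \<times> UNIV)"
      using fam.lp_sum_summable[OF decomp_in[OF x]] unfolding lp_summable_def
      by (rule summable_on_subset) simp
    then show "(\<lambda>i. Ns i (y i) powr p) summable_on (UNIV - J \<times> UNIV)"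
      by (rule summable_on_cong[THEN iffD1, rotated]) (auto simp: y_def split: if_splits)
  qed auto
  moreover have "(J \<times> UNIV) \<union> (UNIV - J \<times> UNIV) = (UNIV :: (int \<times> bool) set)" by blast
  ultimately have "y \<in> lp_sum p Xs Ns" using y_in by (simp add: lp_sum_def lp_summable_def)
  then show ?thesis using x unfolding y_def[symmetric] by (auto simp: decomp_def y_def)
qed

text \<open>Multiplying both limits by the weight turns them into limits of unweighted dual norms,
  to which the hypothesis on the dual of \<open>B0\<close> applies.\<close>

lemma LUR_coordinate:
  assumes LUR: "locally_uniformly_rotund (dual_space sc B0 N0) (dual_norm B0 N0)"
    and h: "represents h f" and H: "\<And>k::nat. represents (H k) (u k)"
    and lim: "(\<lambda>k. dn (H k) (n, False)) \<longlonglongrightarrow> dn h (n, False)"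
      "(\<lambda>k. dn (\<lambda>i. H k i + h i) (n, False)) \<longlonglongrightarrow> 2 * dn h (n, False)"
  shows "(\<lambda>k. dual_norm B0 N0 (H k (n, False) - h (n, False))) \<longlonglongrightarrow> 0"
proof -
  let ?i = "(n, False)" and ?w = "weight (n, False)"
  have space: "dual_space sc (Xs ?i) (Ns ?i) = dual_space sc B0 N0"
    using B0.scaled_norm(2)[OF weight_pos[of ?i]] by (simp add: Xs_def Ns_def[abs_def])
  have dn_eq: "dual_norm (Xs ?i) (Ns ?i) g = dual_norm B0 N0 g / ?w" if "g \<in> dual_space sc B0 N0" for g
    using B0.scaled_norm(3)[OF weight_pos[of ?i] that] by (simp add: Xs_def Ns_def[abs_def])
  have h': "h ?i \<in> dual_space sc B0 N0" using representsD(1)[OF h, of ?i] space by simp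
  have H': "H k ?i \<in> dual_space sc B0 N0" for k using representsD(1)[OF H, of k ?i] space by simp
  have "(\<lambda>k. ?w * dn (H k) ?i) \<longlonglongrightarrow> ?w * dn h ?i"
    "(\<lambda>k. ?w * dn (\<lambda>i. H k i + h i) ?i) \<longlonglongrightarrow> ?w * (2 * dn h ?i)"
    by (intro tendsto_intros lim)+
  then have "(\<lambda>k. dual_norm B0 N0 (H k ?i)) \<longlonglongrightarrow> dual_norm B0 N0 (h ?i)"
    "(\<lambda>k. dual_norm B0 N0 (H k ?i + h ?i)) \<longlonglongrightarrow> 2 * dual_norm B0 N0 (h ?i)"
    using weight_pos[of ?i] dn_eq h' H' B0.dual_space_add[OF H' h'] by simp_all
  moreover have "range (\<lambda>k. H k ?i) \<subseteq> dual_space sc B0 N0" using H' by blast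
  ultimately show ?thesis
    using LUR[unfolded locally_uniformly_rotund_def, rule_format, OF h', of "\<lambda>k. H k ?i"] by blast
qed

lemma locally_uniformly_rotund_interp:
  assumes LUR: "locally_uniformly_rotund (dual_space sc B0 N0) (dual_norm B0 N0)"
  shows "locally_uniformly_rotund (dual_space sc interp_space interp_norm)
           (dual_norm interp_space interp_norm)"
  unfolding locally_uniformly_rotund_def
proof (intro ballI allI impI)
  fix f and u :: "nat \<Rightarrow> 'e \<Rightarrow> complex"
  let ?M = "dual_norm interp_space interp_norm"
  assume f: "f \<in> dual_space sc interp_space interp_norm"
    and "range u \<subseteq> dual_space sc interp_space interp_norm"
    and lim1: "(\<lambda>k. ?M (u k)) \<longlonglongrightarrow> ?M f" and lim2: "(\<lambda>k. ?M (u k + f)) \<longlonglongrightarrow> 2 * ?M f"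
  then have u: "u k \<in> dual_space sc interp_space interp_norm" for k by auto
  obtain h where h: "represents h f" "lp_norm q (dn h) = ?M f" by (rule exists_representation[OF f])
  have "\<exists>H. represents H (u k) \<and> lp_norm q (dn H) = ?M (u k)" for k
    by (rule exists_representation[OF u[of k]]) blast
  then obtain H where H: "\<And>k. represents (H k) (u k)" "\<And>k. lp_norm q (dn (H k)) = ?M (u k)"
    by metis
  note c = representsD[OF h(1)] and s = representsD[OF H(1)]
  note coord = coordinate_limits[OF f u h H lim1 lim2]
  define \<delta> where "\<delta> n k = dual_norm B0 N0 (H k (n, False) - h (n, False))" for n k
  have \<delta>: "(\<lambda>k. \<delta> n k) \<longlonglongrightarrow> 0" for n
    unfolding \<delta>_def by (rule LUR_coordinate[OF LUR h(1) H(1) coord])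
  have q: "0 < q" "0 < p" using pq by auto
  have has_sum_powr: "((\<lambda>i. dn g i powr q) has_sum (lp_norm q (dn g) powr q)) UNIV"
    if "lp_summable q (dn g)" for g
    using that unfolding lp_norm_powr[OF q(1)] lp_summable_def by simp
  show "(\<lambda>k. ?M (u k - f)) \<longlonglongrightarrow> 0"
  proof (rule LIMSEQ_I)
    fix \<epsilon> :: real assume \<epsilon>: "0 < \<epsilon>"
    \<comment> \<open>An element of the unit ball has a decomposition of norm below 2, so the tails
      of the two lifts contribute at most \<open>2 * A\<close> each, together
      \<open>\<epsilon> / 4\<close>. The \<open>B0\<close> and the \<open>B1\<close> terms on the
      finite part receive another \<open>\<epsilon> / 4\<close> each, which leaves the total
      \<open>3 / 4 * \<epsilon>\<close>.\<close>
    define A where "A = \<epsilon> / 16"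
    have A: "0 < A" using \<epsilon> by (simp add: A_def)
    have "\<forall>\<^sub>F J in finite_subsets_at_top UNIV. (\<Sum>i\<in>J. dn h i powr q) > ?M f powr q - A powr q"
      using has_sum_powr[OF c(2)] h(2) A unfolding has_sum_def by (intro order_tendstoD) auto
    then obtain J0 where J0: "finite J0" "\<And>J. finite J \<Longrightarrow> J0 \<subseteq> J \<Longrightarrow> (\<Sum>i\<in>J. dn h i powr q) > ?M f powr q - A powr q"
      unfolding eventually_finite_subsets_at_top by auto
    \<comment> \<open>\<open>J0\<close> is enlarged to full levels, because a level can only be
      replaced with both of its components.\<close>
    define L where "L = fst ` J0"
    define J where "J = L \<times> (UNIV :: bool set)"
    have L: "finite L" and J: "finite J" "J0 \<subseteq> J"
      using J0(1) by (force simp: L_def J_def)+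
    have J_tail: "?M f powr q - (\<Sum>i\<in>J. dn h i powr q) < A powr q" using J0(2)[OF J] by simp
    \<comment> \<open>Bounds the \<open>B1\<close> functionals of both lifts on \<open>L\<close>,
      with the weights taken out: \<open>2 * dn h (n, True) + 1\<close> is
      \<open>dn h (n, True)\<close> for \<open>h\<close> plus \<open>dn h (n, True) + 1\<close>,
      which eventually bounds \<open>dn (H k) (n, True)\<close>.\<close>
    define Q where "Q = (\<Sum>n\<in>L. weight (n, True) * (2 * dn h (n, True) + 1))"
    have Q: "0 \<le> Q" unfolding Q_def using weight_pos c(4) by (intro sum_nonneg mult_nonneg_nonneg add_nonneg_nonneg) (auto simp: less_imp_le)
    have "2 powr (- (1 - \<theta>)) < (1 :: real)" using theta by (intro powr_less_one) auto
    then have "(\<lambda>m. (2 powr (- (1 - \<theta>))) ^ m) \<longlonglongrightarrow> (0 :: real)" by (intro LIMSEQ_realpow_zero) auto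
    then have "(\<lambda>m. 2 powr (- (1 - \<theta>) * real m)) \<longlonglongrightarrow> (0 :: real)"
      by (simp add: powr_powr flip: powr_realpow)
    from tendsto_mult[OF tendsto_const[of "2 * Q"] this]
    have "(\<lambda>m. 2 * Q * 2 powr (- (1 - \<theta>) * real m)) \<longlonglongrightarrow> 0" by simp
    then have "\<forall>\<^sub>F m in sequentially. 2 * Q * 2 powr (- (1 - \<theta>) * real m) < \<epsilon> / 4"
      using \<epsilon> by (intro order_tendstoD) auto
    then obtain m :: nat where m: "2 * Q * 2 powr (- (1 - \<theta>) * real m) < \<epsilon> / 4"
      by (auto simp: eventually_sequentially)
    have "(\<lambda>k. 2 * 2 powr (\<theta> * m) * (\<Sum>n\<in>L. \<delta> n k)) \<longlonglongrightarrow> 2 * 2 powr (\<theta> * m) * (\<Sum>n\<in>L. 0)"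
      by (intro tendsto_intros \<delta>)
    then have ev1: "\<forall>\<^sub>F k in sequentially. 2 * 2 powr (\<theta> * m) * (\<Sum>n\<in>L. \<delta> n k) < \<epsilon> / 4"
      by (rule order_tendstoD(2)) (use \<epsilon> in simp)
    have "\<forall>\<^sub>F k in sequentially. dn (H k) (n, True) < dn h (n, True) + 1" for n
      by (intro order_tendstoD[OF coord(1)]) auto
    then have ev2: "\<forall>\<^sub>F k in sequentially. \<forall>n\<in>L. dn (H k) (n, True) < dn h (n, True) + 1"
      using L by (simp add: eventually_ball_finite)
    \<comment> \<open>The total norms converge, and so do the finitely many coordinates in
      \<open>J\<close>; hence the tails of \<open>H k\<close> eventually satisfy the same bound as
      the tail of \<open>h\<close>.\<close>
    have "(\<lambda>k. ?M (u k) powr q - (\<Sum>i\<in>J. dn (H k) i powr q)) \<longlonglongrightarrow> ?M f powr q - (\<Sum>i\<in>J. dn h i powr q)"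
      using q s(4) I.dual_norm_nonneg[OF u]
      by (intro tendsto_intros tendsto_powr' coord lim1) auto
    then have ev3: "\<forall>\<^sub>F k in sequentially. ?M (u k) powr q - (\<Sum>i\<in>J. dn (H k) i powr q) < A powr q"
      using J_tail by (rule order_tendstoD)
    have "\<forall>\<^sub>F k in sequentially. norm (?M (u k - f) - 0) < \<epsilon>"
      using ev1 ev2 ev3
    proof eventually_elim
      case (elim k)
      have tail: "cmod (\<Sum>i\<in>K. g i (x i)) \<le> A * 2"
        if g: "represents g f'" "lp_norm q (dn g) powr q - (\<Sum>i\<in>J. dn g i powr q) < A powr q"
          and x: "x \<in> decomp a" "lp_sum_norm p Ns x \<le> 2" and K: "finite K" "K \<inter> J = {}" for g f' x a K
      proof (rule fam.finite_pairing_le[OF fam.in_lp_sum[OF decomp_in[OF x(1)]] representsD(1)[OF g(1)] K(1)])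
        have "(\<Sum>i\<in>J. dn g i powr q) + (\<Sum>i\<in>K. dn g i powr q) = (\<Sum>i\<in>J \<union> K. dn g i powr q)"
          using J(1) K by (subst sum.union_disjoint) auto
        also have "\<dots> \<le> lp_norm q (dn g) powr q"
          using J(1) K by (intro sum_le_lp_norm_powr q representsD(2)[OF g(1)]) auto
        finally show "(\<Sum>i\<in>K. dn g i powr q) \<le> A powr q" using g(2) by simp
        have "(\<Sum>i\<in>K. Ns i (x i) powr p) \<le> lp_sum_norm p Ns x powr p"
          unfolding lp_sum_norm_def
          by (intro sum_le_lp_norm_powr q fam.lp_sum_summable decomp_in[OF x(1)] K)
        also have "\<dots> \<le> 2 powr p"
          using x(2) q by (intro powr_mono2) (auto simp: lp_sum_norm_def lp_norm_nonneg)
        finally show "(\<Sum>i\<in>K. Ns i (x i) powr p) \<le> 2 powr p" .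
      qed (use A in auto)
      have "?M (u k - f) \<le> 3 / 4 * \<epsilon>"
      proof (rule I.dual_norm_le)
        fix a assume a: "a \<in> interp_space" "interp_norm a \<le> 1"
        then have "interp_norm a < 2" by simp
        then obtain x where x: "x \<in> decomp a" "lp_sum_norm p Ns x < 2"
          by (rule interp_norm_approx[OF a(1)])
        \<comment> \<open>Both lifts are evaluated at \<open>y\<close>: on \<open>J\<close> only the
          two parts of \<open>a\<close> at level \<open>m\<close> occur, and off \<open>J\<close> it
          equals \<open>x\<close>, so \<open>tail\<close> applies with the bound 2 on the norm of
          \<open>x\<close>.\<close>
        define y where "y = (\<lambda>(n, b). if n \<in> L then x (int m, b) else x (n, b))"
        have y: "y \<in> decomp a" unfolding y_def by (rule decomp_shift[OF x(1) L])
        have "((\<lambda>i. - h i (y i)) has_sum - f a) UNIV"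
          using c(3)[OF y] by (simp add: has_sum_uminus)
        from has_sum_add[OF s(3)[OF y] this]
        have sum: "((\<lambda>i. H k i (y i) - h i (y i)) has_sum (u k - f) a) UNIV" by simp
        have head: "cmod (\<Sum>i\<in>J. H k i (y i) - h i (y i)) \<le> \<epsilon> / 2"
        proof -
          let ?a0 = "x (int m, False)" and ?a1 = "x (int m, True)"
          note cl = component_le[OF x(1), of "int m"]
          have "2 powr (- \<theta> * m) * N0 ?a0 \<le> 2" using cl(2) x(2) by (simp add: weight_def)
          then have a0: "N0 ?a0 \<le> 2 * 2 powr (\<theta> * m)" by (simp add: powr_minus field_simps)
          have "2 powr ((1 - \<theta>) * m) * N1 ?a1 \<le> 2" using cl(4) x(2) by (simp add: weight_def)
          then have a1: "N1 ?a1 \<le> 2 * 2 powr (- (1 - \<theta>) * m)"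
            unfolding mult_minus_left powr_minus by (simp add: field_simps)
          \<comment> \<open>The large factor \<open>2 powr (\<theta> * m)\<close> was fixed before
            \<open>k\<close>, so \<open>ev1\<close> could ask the \<open>\<delta> n k\<close> to
            compensate for it.\<close>
          have t0: "cmod (H k (n, False) ?a0 - h (n, False) ?a0) \<le> \<delta> n k * (2 * 2 powr (\<theta> * m))" for n
          proof -
            have "g (n, False) \<in> dual_space sc B0 N0" if "represents g f'" for g f'
              using representsD(1)[OF that, of "(n, False)"] B0.scaled_norm(2)[OF weight_pos[of "(n, False)"]]
              by (simp add: Xs_def Ns_def[abs_def])
            then have d: "H k (n, False) - h (n, False) \<in> dual_space sc B0 N0"
              using H(1) h(1) by (intro B0.dual_space_diff) auto
            have "cmod (H k (n, False) ?a0 - h (n, False) ?a0) \<le> \<delta> n k * N0 ?a0"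
              using B0.cmod_le_dual_norm[OF d cl(1)] by (simp add: \<delta>_def)
            also have "\<dots> \<le> \<delta> n k * (2 * 2 powr (\<theta> * m))"
              using a0 B0.dual_norm_nonneg[OF d] by (intro mult_left_mono) (auto simp: \<delta>_def)
            finally show ?thesis .
          qed
          have t1: "cmod (H k (n, True) ?a1 - h (n, True) ?a1)
              \<le> (weight (n, True) * (2 * dn h (n, True) + 1)) * (2 * 2 powr (- (1 - \<theta>) * m))" if "n \<in> L" for n
          proof -
            have "?a1 \<in> Xs (n, True)" using cl(3) by (simp add: Xs_def)
            then have "cmod (g (n, True) ?a1) \<le> dn g (n, True) * (weight (n, True) * N1 ?a1)"
              if "represents g f'" for g f'
              using complex_normed_space.cmod_le_dual_norm[OF normed_Xs representsD(1)[OF that]]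
              by (fastforce simp: Ns_def)
            from add_mono[OF this[OF H(1)[of k]] this[OF h(1)]]
            have "cmod (H k (n, True) ?a1 - h (n, True) ?a1)
                \<le> (dn (H k) (n, True) + dn h (n, True)) * (weight (n, True) * N1 ?a1)"
              unfolding distrib_right by (rule norm_triangle_ineq4[THEN order_trans])
            also have "\<dots> \<le> (2 * dn h (n, True) + 1) * (weight (n, True) * (2 * 2 powr (- (1 - \<theta>) * m)))"
              using elim(2) \<open>n \<in> L\<close> a1 weight_pos[of "(n, True)"] c(4)[of "(n, True)"] B1.norm_nonneg[OF cl(3)]
              by (intro mult_mono mult_left_mono mult_nonneg_nonneg) auto
            finally show ?thesis by (simp only: mult_ac)
          qed
          have "(\<Sum>i\<in>J. H k i (y i) - h i (y i)) = (\<Sum>n\<in>L. \<Sum>b\<in>UNIV. H k (n, b) (y (n, b)) - h (n, b) (y (n, b)))"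
            unfolding J_def by (subst sum.cartesian_product) (auto intro: sum.cong)
          also have "\<dots> = (\<Sum>n\<in>L. (H k (n, False) ?a0 - h (n, False) ?a0) + (H k (n, True) ?a1 - h (n, True) ?a1))"
            by (intro sum.cong) (auto simp: UNIV_bool y_def)
          also have "cmod \<dots> \<le> (\<Sum>n\<in>L. \<delta> n k * (2 * 2 powr (\<theta> * m))
              + (weight (n, True) * (2 * dn h (n, True) + 1)) * (2 * 2 powr (- (1 - \<theta>) * m)))"
            by (intro sum_norm_le norm_triangle_mono t0 t1)
          also have "\<dots> = (\<Sum>n\<in>L. \<delta> n k) * (2 * 2 powr (\<theta> * m)) + Q * (2 * 2 powr (- (1 - \<theta>) * m))"
            unfolding Q_def by (simp only: sum.distrib sum_distrib_right)
          also have "\<dots> \<le> \<epsilon> / 2" using elim(1) m by (simp only: mult_ac)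
          finally show ?thesis .
        qed
        have "((\<lambda>i. H k i (y i) - h i (y i)) has_sum ((u k - f) a - (\<Sum>i\<in>J. H k i (y i) - h i (y i)))) (UNIV - J)"
          using sum J(1) by (intro has_sum_Diff) auto
        note rest = tendsto_norm[OF this[unfolded has_sum_def]]
        have "cmod ((u k - f) a - (\<Sum>i\<in>J. H k i (y i) - h i (y i))) \<le> A * 4"
        proof (rule tendsto_upperbound[OF rest])
          show "\<forall>\<^sub>F K in finite_subsets_at_top (UNIV - J). cmod (\<Sum>i\<in>K. H k i (y i) - h i (y i)) \<le> A * 4"
          proof (rule eventually_finite_subsets_at_top_weakI)
            fix K assume K: "finite K" "K \<subseteq> UNIV - J"
            have "y i = x i" if "i \<in> K" for i
              using that K(2) by (cases i) (auto simp: y_def J_def)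
            then have "(\<Sum>i\<in>K. H k i (y i) - h i (y i)) = (\<Sum>i\<in>K. H k i (x i)) - (\<Sum>i\<in>K. h i (x i))"
              by (simp add: sum_subtractf)
            moreover have "cmod (\<Sum>i\<in>K. H k i (x i)) \<le> A * 2"
              by (rule tail[OF H(1) _ x(1)]) (use elim(3) H(2) x(2) K in auto)
            moreover have "cmod (\<Sum>i\<in>K. h i (x i)) \<le> A * 2"
              by (rule tail[OF h(1) _ x(1)]) (use J_tail h(2) x(2) K in auto)
            ultimately show "cmod (\<Sum>i\<in>K. H k i (y i) - h i (y i)) \<le> A * 4"
              using norm_triangle_ineq4[of "\<Sum>i\<in>K. H k i (x i)" "\<Sum>i\<in>K. h i (x i)"] by simp
          qed
        qed simp
        with head show "cmod ((u k - f) a) \<le> 3 / 4 * \<epsilon>"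
          using norm_triangle_ineq2[of "(u k - f) a" "\<Sum>i\<in>J. H k i (y i) - h i (y i)"]
          by (simp add: A_def)
      qed
      then show "norm (?M (u k - f) - 0) < \<epsilon>"
        using I.dual_norm_nonneg[OF I.dual_space_diff[OF u f]] \<epsilon> by simp
    qed
    then show "\<exists>no. \<forall>k\<ge>no. norm (?M (u k - f) - 0) < \<epsilon>"
      by (simp add: eventually_sequentially)
  qed
qed

end

subsection \<open>Comparison of the discrete and the continuous norm\<close>

text \<open>The interval from \<open>2 powr n\<close> to \<open>2 powr (n + 1)\<close> has length
  \<open>2 powr n\<close>, so the constant \<open>c n / 2 powr n\<close> contributes exactly
  \<open>c n\<close>. Comparison with a step function rests on monotonicity of
  \<open>nn_integral\<close>, so no measurability proof for the \<open>K\<close>-functional is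
  called for; \<open>int_decode\<close> enumerates the levels as a series.\<close>

lemma nn_integral_dyadic_le:
  fixes \<phi> :: "real \<Rightarrow> ennreal" and c :: "int \<Rightarrow> real"
  assumes c: "\<And>n. 0 \<le> c n"
    and \<phi>: "\<And>n t. 2 powr n \<le> t \<Longrightarrow> t < 2 powr (n + 1) \<Longrightarrow> \<phi> t \<le> ennreal (c n / 2 powr n)"
    and B: "\<And>J. finite J \<Longrightarrow> (\<Sum>n\<in>J. c n) \<le> B"
  shows "(\<integral>\<^sup>+t\<in>{0<..}. \<phi> t \<partial>lborel) \<le> ennreal B"
proof -
  define I where "I n = {2 powr real_of_int n..<2 powr (real_of_int n + 1)}" for n
  define d where "d j t = ennreal (c (int_decode j) / 2 powr int_decode j) * indicator (I (int_decode j)) t"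
    for j t
  have "\<phi> t * indicator {0<..} t \<le> (\<Sum>j. d j t)" for t :: real
  proof (cases "0 < t")
    case True
    define n where "n = \<lfloor>log 2 t\<rfloor>"
    have "real_of_int n \<le> log 2 t" "log 2 t < real_of_int n + 1"
      unfolding n_def by linarith+
    then have n: "2 powr n \<le> t" "t < 2 powr (n + 1)"
      using True by (simp_all add: le_log_iff log_less_iff)
    have "\<phi> t * indicator {0<..} t \<le> d (int_encode n) t"
      using \<phi>[OF n] n True by (simp add: d_def I_def)
    also have "\<dots> \<le> (\<Sum>j\<in>{int_encode n}. d j t)" by simp
    also have "\<dots> \<le> (\<Sum>j. d j t)" by (rule sum_le_suminf) auto
    finally show ?thesis .
  qed simp
  then have "(\<integral>\<^sup>+t\<in>{0<..}. \<phi> t \<partial>lborel) \<le> (\<integral>\<^sup>+t. (\<Sum>j. d j t) \<partial>lborel)"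
    by (intro nn_integral_mono)
  also have "\<dots> = (\<Sum>j. \<integral>\<^sup>+t. d j t \<partial>lborel)"
    by (intro nn_integral_suminf) (simp add: d_def[abs_def] I_def)
  also have "\<dots> = (\<Sum>j. ennreal (c (int_decode j)))"
  proof (rule suminf_cong)
    fix j
    let ?n = "int_decode j"
    have "emeasure lborel (I ?n) = ennreal (2 powr ?n)"
      by (simp add: I_def powr_add)
    then have "(\<integral>\<^sup>+t. d j t \<partial>lborel) = ennreal (c ?n / 2 powr ?n) * ennreal (2 powr ?n)"
      by (simp add: d_def[abs_def] nn_integral_cmult_indicator I_def)
    also have "\<dots> = ennreal (c ?n)" using c by (simp flip: ennreal_mult')
    finally show "(\<integral>\<^sup>+t. d j t \<partial>lborel) = ennreal (c ?n)" .
  qed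
  also have "\<dots> \<le> ennreal B"
  proof (rule suminf_le_const)
    fix m
    have "(\<Sum>j<m. ennreal (c (int_decode j))) = ennreal (\<Sum>n\<in>int_decode ` {..<m}. c n)"
      using c by (simp add: sum.reindex inj_int_decode inj_on_subset sum_nonneg)
    also have "\<dots> \<le> ennreal B" by (intro ennreal_leI B) simp
    finally show "(\<Sum>j<m. ennreal (c (int_decode j))) \<le> ennreal B" .
  qed auto
  finally show ?thesis .
qed

lemma nn_integral_dyadic_ge:
  fixes \<phi> :: "real \<Rightarrow> ennreal" and c :: "int \<Rightarrow> real"
  assumes c: "\<And>n. 0 \<le> c n"
    and \<phi>: "\<And>n t. 2 powr n \<le> t \<Longrightarrow> t < 2 powr (n + 1) \<Longrightarrow> ennreal (c n / 2 powr n) \<le> \<phi> t"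
    and "finite J"
  shows "ennreal (\<Sum>n\<in>J. c n) \<le> (\<integral>\<^sup>+t\<in>{0<..}. \<phi> t \<partial>lborel)"
proof -
  define I where "I n = {2 powr real_of_int n..<2 powr (real_of_int n + 1)}" for n
  define d where "d n t = ennreal (c n / 2 powr n) * indicator (I n) t" for n :: int and t
  have "ennreal (c n) = (\<integral>\<^sup>+t. d n t \<partial>lborel)" for n
  proof -
    have "emeasure lborel (I n) = ennreal (2 powr n)" by (simp add: I_def powr_add)
    then have "(\<integral>\<^sup>+t. d n t \<partial>lborel) = ennreal (c n / 2 powr n) * ennreal (2 powr n)"
      by (simp add: d_def[abs_def] nn_integral_cmult_indicator I_def)
    also have "\<dots> = ennreal (c n)" using c by (simp flip: ennreal_mult')
    finally show ?thesis by simp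
  qed
  then have "ennreal (\<Sum>n\<in>J. c n) = (\<Sum>n\<in>J. \<integral>\<^sup>+t. d n t \<partial>lborel)"
    using c by (simp flip: sum_ennreal)
  also have "\<dots> = (\<integral>\<^sup>+t. (\<Sum>n\<in>J. d n t) \<partial>lborel)"
    by (intro nn_integral_sum[symmetric]) (simp add: d_def[abs_def] I_def)
  also have "\<dots> \<le> (\<integral>\<^sup>+t\<in>{0<..}. \<phi> t \<partial>lborel)"
  proof (rule nn_integral_mono)
    fix t :: real
    show "(\<Sum>n\<in>J. d n t) \<le> \<phi> t * indicator {0<..} t"
    proof (cases "0 < t")
      case True
      \<comment> \<open>The dyadic intervals are disjoint, so at most one summand is nonzero at
        \<open>t\<close>.\<close>
      have eq: "t \<in> I n \<longleftrightarrow> n = \<lfloor>log 2 t\<rfloor>" for n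
        using True by (auto simp: I_def powr_le_iff less_powr_iff eq_commute[of n] floor_eq_iff)
      have "(\<Sum>n\<in>J. d n t) = (\<Sum>n\<in>J \<inter> {\<lfloor>log 2 t\<rfloor>}. d n t)"
        using \<open>finite J\<close> eq by (intro sum.mono_neutral_right) (auto simp: d_def)
      also have "\<dots> \<le> (\<Sum>n\<in>{\<lfloor>log 2 t\<rfloor>}. d n t)" by (intro sum_mono2) auto
      also have "\<dots> \<le> \<phi> t" using eq[of "\<lfloor>log 2 t\<rfloor>"] \<phi> by (auto simp: d_def I_def)
      finally show ?thesis using True by simp
    next
      case False
      have "t \<notin> I n" for n
        using False powr_gt_zero[of 2 "real_of_int n"] by (auto simp: I_def simp del: powr_gt_zero)
      then show ?thesis by (simp add: d_def)
    qed
  qed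
  finally show ?thesis .
qed

section \<open>Elementary estimates for the \<open>K\<close>-functional\<close>

lemma (in interpolation_couple) K_functional_le:
  assumes "a0 \<in> B0" "a1 \<in> B1" "0 \<le> t"
  shows "K_functional B0 N0 B1 N1 t (a0 + a1) \<le> N0 a0 + t * N1 a1"
  unfolding K_functional_def
  by (rule cInf_lower)
     (use assms B0.norm_nonneg B1.norm_nonneg in \<open>auto intro!: bdd_belowI[of _ 0] add_nonneg_nonneg\<close>)

lemma (in interpolation_couple) K_functional_approx:
  assumes "b0 \<in> B0" "b1 \<in> B1" "a = b0 + b1" "K_functional B0 N0 B1 N1 t a < R"
  obtains a0 a1 where "a0 \<in> B0" "a1 \<in> B1" "a = a0 + a1" "N0 a0 + t * N1 a1 < R"
proof -
  have "{N0 a0 + t * N1 a1 | a0 a1. a0 \<in> B0 \<and> a1 \<in> B1 \<and> a = a0 + a1} \<noteq> {}" using assms by blast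
  from cInf_lessD[OF this assms(4)[unfolded K_functional_def]] that show thesis by auto
qed

lemma (in interpolation_couple) K_functional_greatest:
  assumes "b0 \<in> B0" "b1 \<in> B1" "a = b0 + b1"
    and "\<And>a0 a1. a0 \<in> B0 \<Longrightarrow> a1 \<in> B1 \<Longrightarrow> a = a0 + a1 \<Longrightarrow> c \<le> N0 a0 + t * N1 a1"
  shows "c \<le> K_functional B0 N0 B1 N1 t a"
  unfolding K_functional_def by (rule cInf_greatest) (use assms in blast)+

text \<open>Positivity makes twice the \<open>K\<close>-functional strictly larger than the infimum,
  so that decompositions within a factor 2 of optimal exist at every level.\<close>

lemma (in interpolation_couple) K_functional_pos:
  assumes "b0 \<in> B0" "b1 \<in> B1" "a = b0 + b1" "a \<noteq> 0" "0 < t"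
  shows "0 < K_functional B0 N0 B1 N1 t a"
proof (rule ccontr)
  assume neg: "\<not> 0 < K_functional B0 N0 B1 N1 t a"
  have "a = 0"
  proof (rule small_decompositions_imp_zero)
    fix e :: real assume e: "0 < e"
    moreover have "0 < t * e" using e \<open>0 < t\<close> by simp
    ultimately have "K_functional B0 N0 B1 N1 t a < min e (t * e)" using neg by simp
    then obtain a0 a1 where a: "a0 \<in> B0" "a1 \<in> B1" "a = a0 + a1" "N0 a0 + t * N1 a1 < min e (t * e)"
      by (rule K_functional_approx[OF assms(1-3)])
    have "N0 a0 < e" "t * N1 a1 < t * e"
      using a(4) B0.norm_nonneg[OF a(1)] B1.norm_nonneg[OF a(2)] \<open>0 < t\<close>
      by (smt (verit) mult_nonneg_nonneg)+
    then show "\<exists>a0\<in>B0. \<exists>a1\<in>B1. a = a0 + a1 \<and> N0 a0 < e \<and> N1 a1 < e"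
      using a \<open>0 < t\<close> by auto
  qed
  with assms show False by simp
qed

lemma (in interpolation_couple) K_functional_nonneg:
  assumes "b0 \<in> B0" "b1 \<in> B1" "a = b0 + b1" "0 \<le> t"
  shows "0 \<le> K_functional B0 N0 B1 N1 t a"
  by (rule K_functional_greatest[OF assms(1-3)])
     (use assms B0.norm_nonneg B1.norm_nonneg in auto)

lemma (in interpolation_couple) K_functional_mono:
  assumes "b0 \<in> B0" "b1 \<in> B1" "a = b0 + b1" "0 \<le> s" "s \<le> t"
  shows "K_functional B0 N0 B1 N1 s a \<le> K_functional B0 N0 B1 N1 t a"
proof (rule K_functional_greatest[OF assms(1-3)])
  fix a0 a1 assume a: "a0 \<in> B0" "a1 \<in> B1" "a = a0 + a1"
  have "K_functional B0 N0 B1 N1 s a \<le> N0 a0 + s * N1 a1"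
    using K_functional_le[OF a(1,2) assms(4)] a(3) by simp
  also have "\<dots> \<le> N0 a0 + t * N1 a1"
    using assms B1.norm_nonneg[OF a(2)] by (simp add: mult_right_mono)
  finally show "K_functional B0 N0 B1 N1 s a \<le> N0 a0 + t * N1 a1" .
qed

text \<open>With monotonicity, this controls the \<open>K\<close>-functional on a whole dyadic
  interval by its value at the left end, up to a factor 2.\<close>

lemma (in interpolation_couple) K_functional_double:
  assumes "b0 \<in> B0" "b1 \<in> B1" "a = b0 + b1" "0 \<le> t"
  shows "K_functional B0 N0 B1 N1 (2 * t) a \<le> 2 * K_functional B0 N0 B1 N1 t a"
proof -
  have "K_functional B0 N0 B1 N1 (2 * t) a / 2 \<le> K_functional B0 N0 B1 N1 t a"
  proof (rule K_functional_greatest[OF assms(1-3)])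
    fix a0 a1 assume a: "a0 \<in> B0" "a1 \<in> B1" "a = a0 + a1"
    have "K_functional B0 N0 B1 N1 (2 * t) a \<le> N0 a0 + 2 * t * N1 a1"
      using K_functional_le[OF a(1,2), of "2 * t"] a(3) assms(4) by simp
    then show "K_functional B0 N0 B1 N1 (2 * t) a / 2 \<le> N0 a0 + t * N1 a1"
      using B0.norm_nonneg[OF a(1)] by simp
  qed
  then show ?thesis by simp
qed

section \<open>Equivalence of the discrete and the continuous norm\<close>

context real_interpolation begin

definition dyadic_K :: "'e \<Rightarrow> int \<Rightarrow> real" where
  "dyadic_K a n = 2 powr (- \<theta> * n) * K_functional B0 N0 B1 N1 (2 powr n) a"

lemma dyadic_K_nonneg: "b0 \<in> B0 \<Longrightarrow> b1 \<in> B1 \<Longrightarrow> a = b0 + b1 \<Longrightarrow> 0 \<le> dyadic_K a n"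
  unfolding dyadic_K_def by (intro mult_nonneg_nonneg K_functional_nonneg) auto

text \<open>On a dyadic interval \<open>t powr (- \<theta>)\<close> and \<open>1 / t\<close> are
  largest at the left end, while the \<open>K\<close>-functional at most doubles; that is the factor
  2.\<close>

lemma integral_le_dyadic:
  assumes b: "b0 \<in> B0" "b1 \<in> B1" "a = b0 + b1"
    and R: "\<And>J. finite J \<Longrightarrow> (\<Sum>n\<in>J. (2 * dyadic_K a n) powr p) \<le> R"
  shows "real_interp_integral B0 N0 B1 N1 \<theta> p a \<le> ennreal R"
  unfolding real_interp_integral_def
proof (rule nn_integral_dyadic_le[OF _ _ R])
  let ?K = "\<lambda>t. K_functional B0 N0 B1 N1 t a"
  show "0 \<le> (2 * dyadic_K a n) powr p" for n by simp
  fix n :: int and t :: real assume t: "2 powr n \<le> t" "t < 2 powr (n + 1)"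
  have t0: "0 < t" using t(1) powr_gt_zero[of 2 "real_of_int n"] by (simp del: powr_gt_zero)
  have "t powr (- \<theta>) \<le> (2 powr n) powr (- \<theta>)"
    using theta t(1) by (intro powr_mono2') auto
  then have 1: "t powr (- \<theta>) \<le> 2 powr (- \<theta> * n)" by (simp add: powr_powr mult.commute)
  have "?K t \<le> ?K (2 * 2 powr n)"
    using t t0 by (intro K_functional_mono[OF b]) (auto simp: powr_add)
  also have "\<dots> \<le> 2 * ?K (2 powr n)" by (intro K_functional_double[OF b]) auto
  finally have "t powr (- \<theta>) * ?K t \<le> 2 powr (- \<theta> * n) * (2 * ?K (2 powr n))"
    using 1 t0 by (intro mult_mono K_functional_nonneg[OF b]) auto
  then have "(t powr (- \<theta>) * ?K t) powr p \<le> (2 * dyadic_K a n) powr p"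
    using pq t0 by (intro powr_mono2 mult_nonneg_nonneg K_functional_nonneg[OF b]) (auto simp: dyadic_K_def)
  then show "ennreal ((t powr (- \<theta>) * ?K t) powr p / t) \<le> ennreal ((2 * dyadic_K a n) powr p / 2 powr n)"
    using t(1) by (intro ennreal_leI frac_le) auto
qed

text \<open>Of the factor 4, one 2 pays for the decay of \<open>t powr (- \<theta>)\<close> across
  the interval. The other pays for replacing \<open>1 / t\<close> by its value at the right end:
  that costs 1/2, which is at least \<open>(1 / 2) powr p\<close>.\<close>

lemma dyadic_le_integral:
  assumes b: "b0 \<in> B0" "b1 \<in> B1" "a = b0 + b1" and "finite J"
  shows "ennreal (\<Sum>n\<in>J. (dyadic_K a n / 4) powr p) \<le> real_interp_integral B0 N0 B1 N1 \<theta> p a"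
  unfolding real_interp_integral_def
proof (rule nn_integral_dyadic_ge[OF _ _ \<open>finite J\<close>])
  let ?K = "\<lambda>t. K_functional B0 N0 B1 N1 t a"
  show "0 \<le> (dyadic_K a n / 4) powr p" for n by simp
  fix n :: int and t :: real assume t: "2 powr n \<le> t" "t < 2 powr (n + 1)"
  have t0: "0 < t" using t(1) powr_gt_zero[of 2 "real_of_int n"] by (simp del: powr_gt_zero)
  have half: "2 powr (- 1) = (1 / 2 :: real)" by (simp add: powr_minus)
  have "2 powr (- \<theta> * n) / 2 \<le> 2 powr (- \<theta> * (n + 1))"
  proof -
    have "2 powr (- 1 :: real) \<le> 2 powr (- \<theta>)" using theta by (intro powr_mono) auto
    then have "2 powr (- \<theta> * n) * (1 / 2) \<le> 2 powr (- \<theta> * n) * 2 powr (- \<theta>)"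
      unfolding half by (intro mult_left_mono) auto
    then show ?thesis by (simp add: algebra_simps flip: powr_add)
  qed
  also have "2 powr (- \<theta> * (n + 1)) = (2 powr (n + 1)) powr (- \<theta>)"
    by (simp add: powr_powr mult.commute)
  also have "\<dots> \<le> t powr (- \<theta>)" using theta t t0 by (intro powr_mono2') auto
  finally have 1: "2 powr (- \<theta> * n) / 2 \<le> t powr (- \<theta>)" .
  have "dyadic_K a n / 2 = 2 powr (- \<theta> * n) / 2 * ?K (2 powr n)" by (simp add: dyadic_K_def)
  also have "\<dots> \<le> t powr (- \<theta>) * ?K t"
    using 1 t by (intro mult_mono K_functional_nonneg[OF b] K_functional_mono[OF b]) auto
  finally have 2: "(dyadic_K a n / 2) powr p \<le> (t powr (- \<theta>) * ?K t) powr p"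
    using pq dyadic_K_nonneg[OF b] by (intro powr_mono2) auto
  have "(dyadic_K a n / 4) powr p = (dyadic_K a n / 2 * (1 / 2)) powr p" by simp
  also have "\<dots> = (dyadic_K a n / 2) powr p * (1 / 2) powr p"
    using dyadic_K_nonneg[OF b] by (intro powr_mult) 
  also have "\<dots> \<le> (dyadic_K a n / 2) powr p * (1 / 2)"
    using pq powr_mono'[of 1 p "1 / 2 :: real"] by (intro mult_left_mono) auto
  finally have "(dyadic_K a n / 4) powr p / 2 powr n \<le> (dyadic_K a n / 2) powr p / 2 powr (n + 1)"
    by (simp add: powr_add field_simps)
  also have "\<dots> \<le> (t powr (- \<theta>) * ?K t) powr p / t"
    using 2 t t0 by (intro frac_le) auto
  finally show "ennreal ((dyadic_K a n / 4) powr p / 2 powr n) \<le> ennreal ((t powr (- \<theta>) * ?K t) powr p / t)"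
    by (rule ennreal_leI)
qed

text \<open>The constant 4 is the 2 of \<open>integral_le_dyadic\<close> times the 2 from bounding
  the sum of two components by twice their maximum.\<close>

lemma decomp_imp_real_interp:
  assumes x: "x \<in> decomp a"
  shows "a \<in> real_interp_space B0 N0 B1 N1 \<theta> p"
    and "real_interp_norm B0 N0 B1 N1 \<theta> p a \<le> 4 * lp_sum_norm p Ns x"
proof -
  let ?R = "lp_sum_norm p Ns x"
  have R: "0 \<le> ?R" by (simp add: lp_sum_norm_def lp_norm_nonneg)
  have p: "0 < p" using pq by simp
  have b: "x (n, False) \<in> B0" "x (n, True) \<in> B1" "a = x (n, False) + x (n, True)" for n
    using component_le[OF x] x by (auto simp: decomp_def)
  have x_in: "x i \<in> Xs i" for i by (rule fam.in_lp_sum[OF decomp_in[OF x]])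
  have K: "dyadic_K a n \<le> Ns (n, False) (x (n, False)) + Ns (n, True) (x (n, True))" for n
  proof -
    have "dyadic_K a n \<le> 2 powr (- \<theta> * n) * (N0 (x (n, False)) + 2 powr n * N1 (x (n, True)))"
      unfolding dyadic_K_def using K_functional_le[OF b(1,2), of "2 powr n" n n] b(3)[of n]
      by (intro mult_left_mono) auto
    also have "\<dots> = Ns (n, False) (x (n, False)) + Ns (n, True) (x (n, True))"
      by (simp add: Ns_def weight_def distrib_left left_diff_distrib powr_diff powr_minus field_simps)
    finally show ?thesis .
  qed
  have "(\<Sum>n\<in>J. (2 * dyadic_K a n) powr p) \<le> (4 * ?R) powr p" if "finite J" for J
  proof -
    have "(2 * dyadic_K a n) powr p \<le> 4 powr p * (\<Sum>b\<in>UNIV. Ns (n, b) (x (n, b)) powr p)" for n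
    proof -
      let ?u = "Ns (n, False) (x (n, False))" and ?v = "Ns (n, True) (x (n, True))"
      have nn: "0 \<le> ?u" "0 \<le> ?v" using fam.N_nonneg[OF x_in] by auto
      have "(2 * dyadic_K a n) powr p \<le> (4 * max ?u ?v) powr p"
        using K[of n] dyadic_K_nonneg[OF b] p by (intro powr_mono2) auto
      also have "\<dots> = 4 powr p * (max ?u ?v) powr p" using nn by (intro powr_mult) 
      also have "\<dots> \<le> 4 powr p * (?u powr p + ?v powr p)"
        by (intro mult_left_mono) (auto simp: max_def)
      finally show ?thesis by (simp add: UNIV_bool add.commute)
    qed
    then have "(\<Sum>n\<in>J. (2 * dyadic_K a n) powr p)
        \<le> (\<Sum>n\<in>J. 4 powr p * (\<Sum>b\<in>UNIV. Ns (n, b) (x (n, b)) powr p))"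
      by (intro sum_mono)
    also have "\<dots> = 4 powr p * (\<Sum>i\<in>J \<times> UNIV. Ns i (x i) powr p)"
      by (simp add: sum_distrib_left[symmetric] sum.cartesian_product split_def)
    also have "\<dots> \<le> 4 powr p * ?R powr p"
      unfolding lp_sum_norm_def using that
      by (intro mult_left_mono sum_le_lp_norm_powr p fam.lp_sum_summable decomp_in[OF x]) auto
    also have "\<dots> = (4 * ?R) powr p" using R by (simp add: powr_mult)
    finally show ?thesis .
  qed
  then have I: "real_interp_integral B0 N0 B1 N1 \<theta> p a \<le> ennreal ((4 * ?R) powr p)"
    by (intro integral_le_dyadic[OF b[of 0]]) auto
  then show "a \<in> real_interp_space B0 N0 B1 N1 \<theta> p"
    using b[of 0] unfolding real_interp_space_def by (auto intro: le_less_trans)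
  have "enn2real (real_interp_integral B0 N0 B1 N1 \<theta> p a) \<le> (4 * ?R) powr p"
    using I by (simp add: enn2real_leI)
  then have "real_interp_norm B0 N0 B1 N1 \<theta> p a \<le> ((4 * ?R) powr p) powr (1 / p)"
    unfolding real_interp_norm_def using p by (intro powr_mono2) auto
  then show "real_interp_norm B0 N0 B1 N1 \<theta> p a \<le> 4 * ?R"
    using p R by (simp add: powr_powr)
qed

text \<open>Decompositions within a factor 2 of optimal have weighted components at most
  \<open>2 * dyadic_K a n\<close>, written as \<open>8 * (dyadic_K a n / 4)\<close> to fit
  \<open>dyadic_le_integral\<close>. Two components per level give a further factor 2, which is at
  most \<open>2 powr p\<close>, hence 16.\<close>

lemma real_interp_imp_decomp:
  assumes a: "a \<in> real_interp_space B0 N0 B1 N1 \<theta> p"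
  obtains x where "x \<in> decomp a" "lp_sum_norm p Ns x \<le> 16 * real_interp_norm B0 N0 B1 N1 \<theta> p a"
proof (cases "a = 0")
  case True
  have "lp_sum_norm p Ns 0 = 0"
    using complex_normed_space.norm_zero[OF fam.complex_normed_space_lp_sum] .
  then show thesis
    using that[of 0] zero_decomp True by (simp add: real_interp_norm_def)
next
  case False
  let ?N = "real_interp_norm B0 N0 B1 N1 \<theta> p a"
  have N: "0 \<le> ?N" by (simp add: real_interp_norm_def)
  have p: "0 < p" "1 \<le> p" using pq by auto
  obtain b0 b1 where b: "b0 \<in> B0" "b1 \<in> B1" "a = b0 + b1"
    and fin: "real_interp_integral B0 N0 B1 N1 \<theta> p a < \<infinity>"
    using a by (auto simp: real_interp_space_def)
  have sumK: "(\<Sum>n\<in>J. (dyadic_K a n / 4) powr p) \<le> ?N powr p" if "finite J" for J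
  proof -
    have "(\<Sum>n\<in>J. (dyadic_K a n / 4) powr p) \<le> enn2real (real_interp_integral B0 N0 B1 N1 \<theta> p a)"
      using enn2real_mono[OF dyadic_le_integral[OF b that]] fin by (simp add: sum_nonneg)
    also have "\<dots> = ?N powr p" using p by (simp add: real_interp_norm_def powr_powr)
    finally show ?thesis .
  qed
  have "\<exists>a0 a1. a0 \<in> B0 \<and> a1 \<in> B1 \<and> a = a0 + a1 \<and>
      N0 a0 + 2 powr n * N1 a1 < 2 * K_functional B0 N0 B1 N1 (2 powr n) a" for n :: int
  proof -
    \<comment> \<open>Strict only for nonzero \<open>a\<close>; for \<open>a = 0\<close> the zero
      family served as the witness.\<close>
    have "K_functional B0 N0 B1 N1 (2 powr n) a < 2 * K_functional B0 N0 B1 N1 (2 powr n) a"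
      using K_functional_pos[OF b False, of "2 powr n"] by simp
    then show ?thesis by (rule K_functional_approx[OF b]) blast
  qed
  then obtain a0 a1 :: "int \<Rightarrow> 'e" where dec: "\<And>n. a0 n \<in> B0" "\<And>n. a1 n \<in> B1" "\<And>n. a = a0 n + a1 n"
    "\<And>n::int. N0 (a0 n) + 2 powr n * N1 (a1 n) < 2 * K_functional B0 N0 B1 N1 (2 powr n) a"
    by metis
  define x where "x = (\<lambda>(n, b). if b then a1 n else a0 n)"
  have x_in: "x i \<in> Xs i" for i using dec by (cases i) (auto simp: x_def Xs_def)
  have Ns_le: "Ns (n, b) (x (n, b)) \<le> 8 * (dyadic_K a n / 4)" for n b
  proof -
    have le: "2 powr (- \<theta> * n) * (N0 (a0 n) + 2 powr n * N1 (a1 n)) \<le> 2 * dyadic_K a n"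
      unfolding dyadic_K_def using mult_left_mono[OF less_imp_le[OF dec(4)[of n]], of "2 powr (- \<theta> * n)"]
      by simp
    have "Ns (n, b) (x (n, b)) \<le> 2 powr (- \<theta> * n) * (N0 (a0 n) + 2 powr n * N1 (a1 n))"
    proof (cases b)
      case True
      have "weight (n, True) = 2 powr (- \<theta> * n) * 2 powr n"
        by (simp add: weight_def algebra_simps flip: powr_add)
      then show ?thesis using True B0.norm_nonneg[OF dec(1)[of n]]
        by (simp add: Ns_def x_def distrib_left)
    next
      case False
      then show ?thesis using B1.norm_nonneg[OF dec(2)[of n]]
        by (simp add: Ns_def x_def weight_def)
    qed
    with le show ?thesis by simp
  qed
  have "(\<Sum>i\<in>F. Ns i (x i) powr p) \<le> (16 * ?N) powr p" if "finite F" for F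
  proof -
    have scaled: "(8 * (dyadic_K a n / 4)) powr p = 8 powr p * (dyadic_K a n / 4) powr p" for n
      by (rule powr_mult)
    have "(\<Sum>i\<in>F. Ns i (x i) powr p) \<le> (\<Sum>i\<in>fst ` F \<times> UNIV. Ns i (x i) powr p)"
      using that by (intro sum_mono2) (auto simp: image_iff Bex_def)
    also have "\<dots> = (\<Sum>n\<in>fst ` F. \<Sum>b\<in>UNIV. Ns (n, b) (x (n, b)) powr p)"
      by (simp add: sum.cartesian_product split_def)
    also have "\<dots> \<le> (\<Sum>n\<in>fst ` F. \<Sum>b\<in>(UNIV :: bool set). (8 * (dyadic_K a n / 4)) powr p)"
      using fam.N_nonneg[OF x_in] p by (intro sum_mono powr_mono2 Ns_le) auto
    also have "\<dots> = (\<Sum>n\<in>fst ` F. 2 * 8 powr p * (dyadic_K a n / 4) powr p)"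
      by (simp only: scaled sum_constant card_UNIV_bool of_nat_numeral mult.assoc)
    also have "\<dots> = 2 * 8 powr p * (\<Sum>n\<in>fst ` F. (dyadic_K a n / 4) powr p)"
      by (simp only: sum_distrib_left)
    also have "\<dots> \<le> 2 * 8 powr p * ?N powr p" using that by (intro mult_left_mono sumK) auto
    also have "\<dots> \<le> 2 powr p * 8 powr p * ?N powr p"
      using powr_mono[of 1 p "2 :: real"] p by (intro mult_right_mono) auto
    also have "\<dots> = (16 * ?N) powr p" using N powr_mult[of 2 8 p] by (simp add: powr_mult)
    finally show ?thesis .
  qed
  then have *: "lp_summable p (\<lambda>i. Ns i (x i))" "lp_norm p (\<lambda>i. Ns i (x i)) \<le> 16 * ?N"
    using lp_normI[OF p(1), of "16 * ?N" "\<lambda>i. Ns i (x i)"] N by simp_all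
  show thesis
  proof
    have "x \<in> lp_sum p Xs Ns" using *(1) x_in by (simp add: lp_sum_def)
    then show "x \<in> decomp a" using dec(3) by (simp add: decomp_def x_def)
    show "lp_sum_norm p Ns x \<le> 16 * ?N" using *(2) by (simp add: lp_sum_norm_def)
  qed
qed

lemma interp_space_eq: "interp_space = real_interp_space B0 N0 B1 N1 \<theta> p"
  using decomp_imp_real_interp(1) real_interp_imp_decomp unfolding interp_space_def by blast

lemma equivalent_interp_norm:
  "equivalent_norm sc interp_space (real_interp_norm B0 N0 B1 N1 \<theta> p) interp_norm"
proof -
  let ?N = "real_interp_norm B0 N0 B1 N1 \<theta> p"
  have "1 / 4 * ?N a \<le> interp_norm a \<and> interp_norm a \<le> 16 * ?N a" if a: "a \<in> interp_space" for a
  proof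
    have "1 / 4 * ?N a \<le> r" if "r \<in> lp_sum_norm p Ns ` decomp a" for r
      using that decomp_imp_real_interp(2) by force
    then show "1 / 4 * ?N a \<le> interp_norm a"
      unfolding interp_norm_def using a by (intro cInf_greatest) (auto simp: interp_space_def)
    obtain x where "x \<in> decomp a" "lp_sum_norm p Ns x \<le> 16 * ?N a"
      using real_interp_imp_decomp a interp_space_eq by blast
    then show "interp_norm a \<le> 16 * ?N a" using interp_norm_le order_trans by blast
  qed
  moreover have "(0 :: real) < 1 / 4" "(0 :: real) < 16" by simp_all
  ultimately show ?thesis
    unfolding equivalent_norm_def using complex_normed_space_interp by blast
qed

end

section \<open>Dual spaces under renorming and the conclusion\<close>

lemma dual_space_equivalent_norm:
  assumes "equivalent_norm sc X N N'"
  shows "dual_space sc X N = dual_space sc X N'"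
proof -
  obtain c C where c: "0 < c" "0 < C" "\<And>x. x \<in> X \<Longrightarrow> c * N x \<le> N' x \<and> N' x \<le> C * N x"
    and N': "complex_normed_space sc X N'"
    using assms unfolding equivalent_norm_def by blast
  \<comment> \<open>\<open>equivalent_norm\<close> asserts the norm axioms for \<open>N'\<close>
    alone, so the sign of \<open>N\<close> is derived from the comparison with
    \<open>N'\<close>.\<close>
  have pos: "0 \<le> N x" if "x \<in> X" for x
    using complex_normed_space.norm_nonneg[OF N' that] c(3)[OF that] c(2)
    by (meson order_trans zero_le_mult_iff not_less)
  have "(\<exists>K. \<forall>x\<in>X. cmod (f x) \<le> K * N x) \<longleftrightarrow> (\<exists>K. \<forall>x\<in>X. cmod (f x) \<le> K * N' x)" for f
  proof
    assume "\<exists>K. \<forall>x\<in>X. cmod (f x) \<le> K * N x"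
    then obtain K where K: "\<And>x. x \<in> X \<Longrightarrow> cmod (f x) \<le> K * N x" by blast
    have "cmod (f x) \<le> (\<bar>K\<bar> / c) * N' x" if x: "x \<in> X" for x
    proof -
      have "cmod (f x) \<le> \<bar>K\<bar> * N x" using K[OF x] pos[OF x] by (meson abs_ge_self mult_right_mono order_trans)
      also have "\<dots> \<le> \<bar>K\<bar> * (N' x / c)"
        using c(3)[OF x] c(1) by (intro mult_left_mono) (auto simp: field_simps)
      finally show ?thesis by simp
    qed
    then show "\<exists>K. \<forall>x\<in>X. cmod (f x) \<le> K * N' x" by blast
  next
    assume "\<exists>K. \<forall>x\<in>X. cmod (f x) \<le> K * N' x"
    then obtain K where K: "\<And>x. x \<in> X \<Longrightarrow> cmod (f x) \<le> K * N' x" by blast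
    have "cmod (f x) \<le> (\<bar>K\<bar> * C) * N x" if x: "x \<in> X" for x
    proof -
      have "cmod (f x) \<le> \<bar>K\<bar> * N' x"
        using K[OF x] complex_normed_space.norm_nonneg[OF N' x]
        by (meson abs_ge_self mult_right_mono order_trans)
      also have "\<dots> \<le> \<bar>K\<bar> * (C * N x)" using c(3)[OF x] by (intro mult_left_mono) auto
      finally show ?thesis by (simp add: mult.assoc)
    qed
    then show "\<exists>K. \<forall>x\<in>X. cmod (f x) \<le> K * N x" by blast
  qed
  then show ?thesis by (simp add: dual_space_def)
qed

theorem theorem9p1:
  fixes sc :: "complex \<Rightarrow> 'e::{topological_ab_group_add, t2_space} \<Rightarrow> 'e"
    and B0 B1 :: "'e set" and N0 N1 :: "'e \<Rightarrow> real" and \<theta> p :: real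
  assumes "interpolation_couple sc B0 N0 B1 N1"
    and "0 < \<theta>" and "\<theta> < 1" and "1 < p"
    and "locally_uniformly_rotund (dual_space sc B0 N0) (dual_norm B0 N0)"
  shows "\<exists>M. equivalent_dual_norm sc
               (real_interp_space B0 N0 B1 N1 \<theta> p) (real_interp_norm B0 N0 B1 N1 \<theta> p) M \<and>
             locally_uniformly_rotund
               (dual_space sc
                  (real_interp_space B0 N0 B1 N1 \<theta> p) (real_interp_norm B0 N0 B1 N1 \<theta> p)) M"
proof -
  interpret couple: interpolation_couple sc B0 N0 B1 N1 by (rule assms(1))
  define q where "q = p / (p - 1)"
  have q: "1 < q" "1 / p + 1 / q = 1" using assms(4) by (simp_all add: q_def field_simps)
  interpret real_interpolation sc B0 N0 B1 N1 \<theta> p q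
    by unfold_locales (use assms q in auto)
  note dual_eq = dual_space_equivalent_norm[OF equivalent_interp_norm]
  have "equivalent_dual_norm sc interp_space (real_interp_norm B0 N0 B1 N1 \<theta> p)
      (dual_norm interp_space interp_norm)"
    unfolding equivalent_dual_norm_def dual_eq
    using I.complex_normed_space_dual equivalent_interp_norm by blast
  with locally_uniformly_rotund_interp[OF assms(5)] show ?thesis
    unfolding interp_space_eq[symmetric] dual_eq by blast
qed

end
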